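(* Let $n$ be the number of items in the universe, $k$ the number of servers, and $\varepsilon\in(0,1)$ the accuracy parameter. There exists a distributed $(\gamma,\varepsilon)$-continuous difference estimator for the distinct elements problem (i.e., for $F=F_0$) that uses $O\!\left(\frac{k\gamma}{\varepsilon^2}\log^2 n\right)$ bits of communication.
   Context: Distributed monitoring (coordinator) model: $k$ servers and a coordinator with private two-way channels; insertion-only stream of updates each incrementing one coordinate of $[n]$ at one server. $F_0(f)=|\{i:f_i\neq0\}|$. A $(\gamma,\varepsilon)$-continuous difference estimator for $F$: given a splitting time $t_0$, with $u$ the frequency vector induced by updates up to $t_0$ and $v$ that induced by updates after $t_0$ up to the current time, under the promise $F(u+v)-F(u)\le\gamma F(u)$ and $F(v)\le\gamma F(u)$, it outputs at all times an estimate of $F(u+v)-F(u)$ with additive error $\varepsilon F(u)$, with probability at least $1-1/\mathrm{poly}(n)$.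
   Formalization: The English gives no range for γ; here γ lies in (0, Γ] for an arbitrary fixed Γ > 0 and the O-constant may depend on Γ (and on the exponent in 1/poly(n)), since a constant uniform over all γ is impossible by a Gap-Hamming lower bound. *)

theory Defs
  imports "HOL-Probability.Probability" "HOL-Probability.Product_PMF"
    "HOL-Library.While_Combinator"
begin

text \<open>Items are \<open>{..<n}\<close> and servers \<open>{..<k}\<close>; an update \<open>(j, i)\<close> increments coordinate
  \<open>i\<close> at server \<open>j\<close>.\<close>

type_synonym stream = "(nat \<times> nat) list"

definition valid_stream :: "nat \<Rightarrow> nat \<Rightarrow> stream \<Rightarrow> bool" where
  "valid_stream n k s \<longleftrightarrow> set s \<subseteq> {..<k} \<times> {..<n}"

definition freq :: "stream \<Rightarrow> nat \<Rightarrow> nat" where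
  "freq s i = length (filter (\<lambda>(_, i'). i' = i) s)"

definition F0 :: "nat \<Rightarrow> (nat \<Rightarrow> nat) \<Rightarrow> real" where
  "F0 n f = real (card {i. i < n \<and> f i \<noteq> 0})"

text \<open>The coordinator model is message driven and has no clock: a party is activated only when
  it observes something (an arriving update, the signal that the splitting time has come, or a
  message), and then it may send messages.  Silence is free, but every message is a nonempty
  bit string charged with its length, so neither empty messages nor delays carry free
  information.  Only the coordinator is told about the splitting time, and only when it comes.

  What a party does is a function of its private coins and of the sequence of its own
  observations (its own past messages are determined by these).  The coins of each party are
  drawn once, encoded as a natural number, independently of those of all other parties.\<close>

type_synonym msg = "bool list"

datatype server_obs = Item nat | From_Coord msg
datatype coord_obs = Split | From_Server nat msg
datatype packet = To_Coord nat msg | To_Server nat msg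
datatype event = Arrival nat nat | Splitting

record protocol =
  server_coins :: "nat \<Rightarrow> nat pmf"
  coord_coins :: "nat pmf"
  server_act :: "nat \<Rightarrow> nat \<Rightarrow> server_obs list \<Rightarrow> msg option"
  coord_act :: "nat \<Rightarrow> coord_obs list \<Rightarrow> (nat \<times> msg) list"
  coord_out :: "nat \<Rightarrow> coord_obs list \<Rightarrow> real"

definition wf_protocol :: "nat \<Rightarrow> protocol \<Rightarrow> bool" where
  "wf_protocol k P \<longleftrightarrow>
     (\<forall>j r h. server_act P j r h \<noteq> Some []) \<and>
     (\<forall>r h. \<forall>(j, m) \<in> set (coord_act P r h). j < k \<and> m \<noteq> [])"

text \<open>Coins of the coordinator, paired with the coins of the servers.\<close>

type_synonym coins = "nat \<times> (nat \<Rightarrow> nat)"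

definition coins_pmf :: "nat \<Rightarrow> protocol \<Rightarrow> coins pmf" where
  "coins_pmf k P = pair_pmf (coord_coins P) (Pi_pmf {..<k} 0 (server_coins P))"

record config =
  server_view :: "nat \<Rightarrow> server_obs list"
  coord_view :: "coord_obs list"
  pending :: "packet list"
  bits :: nat

definition init_config :: config where
  "init_config = \<lparr>server_view = (\<lambda>_. []), coord_view = [], pending = [], bits = 0\<rparr>"

fun packet_bits :: "packet \<Rightarrow> nat" where
  "packet_bits (To_Coord j m) = length m"
| "packet_bits (To_Server j m) = length m"

definition send :: "packet list \<Rightarrow> config \<Rightarrow> config" where
  "send ps c = c\<lparr>pending := pending c @ ps, bits := bits c + sum_list (map packet_bits ps)\<rparr>"

definition server_observe ::
    "protocol \<Rightarrow> coins \<Rightarrow> nat \<Rightarrow> server_obs \<Rightarrow> config \<Rightarrow> config" where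
  "server_observe P R j ob c =
     (let h = server_view c j @ [ob] in
      send (case server_act P j (snd R j) h of None \<Rightarrow> [] | Some m \<Rightarrow> [To_Coord j m])
        (c\<lparr>server_view := (server_view c)(j := h)\<rparr>))"

definition coord_observe :: "protocol \<Rightarrow> coins \<Rightarrow> coord_obs \<Rightarrow> config \<Rightarrow> config" where
  "coord_observe P R ob c =
     (let h = coord_view c @ [ob] in
      send (map (\<lambda>(j, m). To_Server j m) (coord_act P (fst R) h)) (c\<lparr>coord_view := h\<rparr>))"

fun deliver :: "protocol \<Rightarrow> coins \<Rightarrow> packet \<Rightarrow> config \<Rightarrow> config" where
  "deliver P R (To_Coord j m) c = coord_observe P R (From_Server j m) c"
| "deliver P R (To_Server j m) c = server_observe P R j (From_Coord m) c"

text \<open>Packets are delivered in the order in which they were sent, until none is pending;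
  \<open>None\<close> means that the parties never stop communicating.\<close>

definition settle :: "protocol \<Rightarrow> coins \<Rightarrow> config \<Rightarrow> config option" where
  "settle P R = while_option (\<lambda>c. pending c \<noteq> [])
     (\<lambda>c. deliver P R (hd (pending c)) (c\<lparr>pending := tl (pending c)\<rparr>))"

fun inject :: "protocol \<Rightarrow> coins \<Rightarrow> event \<Rightarrow> config \<Rightarrow> config" where
  "inject P R (Arrival j i) c = server_observe P R j (Item i) c"
| "inject P R Splitting c = coord_observe P R Split c"

fun run_events :: "protocol \<Rightarrow> coins \<Rightarrow> event list \<Rightarrow> config \<Rightarrow> config option" where
  "run_events P R [] c = Some c"
| "run_events P R (e # es) c =
     Option.bind (settle P R (inject P R e c)) (run_events P R es)"

text \<open>The configuration after all updates of \<open>s\<close>, with the splitting time right after the first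
  \<open>t0\<close> of them.\<close>

definition run :: "protocol \<Rightarrow> coins \<Rightarrow> nat \<Rightarrow> stream \<Rightarrow> config option" where
  "run P R t0 s = run_events P R
     (map (\<lambda>(j, i). Arrival j i) (take t0 s) @ Splitting #
      map (\<lambda>(j, i). Arrival j i) (drop t0 s)) init_config"

definition pre_vec :: "nat \<Rightarrow> stream \<Rightarrow> nat \<Rightarrow> nat" where
  "pre_vec t0 s = freq (take t0 s)"

definition post_vec :: "nat \<Rightarrow> nat \<Rightarrow> stream \<Rightarrow> nat \<Rightarrow> nat" where
  "post_vec t0 t s = freq (drop t0 (take t s))"

definition difference :: "((nat \<Rightarrow> nat) \<Rightarrow> real) \<Rightarrow> (nat \<Rightarrow> nat) \<Rightarrow> (nat \<Rightarrow> nat) \<Rightarrow> real" where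
  "difference F u v = F (\<lambda>i. u i + v i) - F u"

definition promise_input ::
    "nat \<Rightarrow> nat \<Rightarrow> ((nat \<Rightarrow> nat) \<Rightarrow> real) \<Rightarrow> real \<Rightarrow> nat \<Rightarrow> stream \<Rightarrow> bool" where
  "promise_input n k F \<gamma> t0 s \<longleftrightarrow>
     valid_stream n k s \<and> t0 \<le> length s \<and>
     (\<forall>t \<in> {t0..length s}.
        difference F (pre_vec t0 s) (post_vec t0 t s) \<le> \<gamma> * F (pre_vec t0 s) \<and>
        F (post_vec t0 t s) \<le> \<gamma> * F (pre_vec t0 s))"

text \<open>The input is fixed before the coins are drawn, and a single event of probability at least
  \<open>1 - \<delta>\<close> guarantees the accuracy at all times.\<close>

definition continuous_difference_estimator ::
    "nat \<Rightarrow> nat \<Rightarrow> ((nat \<Rightarrow> nat) \<Rightarrow> real) \<Rightarrow> real \<Rightarrow> real \<Rightarrow> real \<Rightarrow> protocol \<Rightarrow> bool" where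
  "continuous_difference_estimator n k F \<gamma> \<epsilon> \<delta> P \<longleftrightarrow>
     wf_protocol k P \<and>
     (\<forall>t0 s. promise_input n k F \<gamma> t0 s \<longrightarrow>
        measure_pmf.prob (coins_pmf k P)
          {R. \<forall>t \<in> {t0..length s}. \<exists>c. run P R t0 (take t s) = Some c \<and>
                \<bar>coord_out P (fst R) (coord_view c)
                   - difference F (pre_vec t0 s) (post_vec t0 t s)\<bar> \<le> \<epsilon> * F (pre_vec t0 s)}
        \<ge> 1 - \<delta>)"

text \<open>Worst-case communication: all inputs satisfying the promise, all outcomes of the coins.
  Bits sent before the splitting time count as well.\<close>

definition communication_at_most ::
    "nat \<Rightarrow> nat \<Rightarrow> ((nat \<Rightarrow> nat) \<Rightarrow> real) \<Rightarrow> real \<Rightarrow> protocol \<Rightarrow> real \<Rightarrow> bool" where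
  "communication_at_most n k F \<gamma> P B \<longleftrightarrow>
     (\<forall>t0 s. promise_input n k F \<gamma> t0 s \<longrightarrow>
        (\<forall>R \<in> set_pmf (coins_pmf k P). \<exists>c. run P R t0 s = Some c \<and> real (bits c) \<le> B))"

end

theory Submission
  imports Defs
begin

text \<open>If \<open>\<gamma> \<le> \<epsilon>\<close>, the constant estimate 0 is accurate. Otherwise the items are subsampled: a hash
  with geometric values assigns to each item a level, and \<open>S l\<close> consists of the items of level at
  least \<open>l\<close>, each with probability \<open>2 ^ - l\<close>. Let \<open>U\<close> be the set of items before the splitting
  time and \<open>l\<close> the least level with at most \<open>cap = O(\<gamma> log n / \<epsilon>\<^sup>2)\<close> items in \<open>U \<inter> S l\<close>. A
  Chernoff bound shows that \<open>2 ^ l\<close> times the number of new items in \<open>S l\<close> has error at most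
  \<open>\<epsilon> * card U\<close>, except with probability \<open>1 / poly n\<close>; the new items form an increasing chain of at
  most \<open>n + 1\<close> sets, so a union bound covers all times. Independent draws show that
  polynomially many hash functions suffice for all inputs at once, so a hash is described by
  \<open>O(log n)\<close> bits.

  Nothing is sent before the splitting time. Then the coordinator broadcasts the hash, every server
  replies with the least level at which its own sample has at most \<open>cap\<close> items, together with that
  sample, which suffices for the coordinator to find \<open>l\<close> and \<open>U \<inter> S l\<close>. It broadcasts \<open>l\<close>, and from
  then on the servers forward the new items in \<open>S l\<close>, up to a cutoff that is reached only
  if the hash is bad. Each server exchanges \<open>O(cap)\<close> items of \<open>O(log n)\<close> bits.\<close>

section \<open>Concentration of level sets of a geometric hash\<close>

lemma exp_le_quadratic:
  fixes x :: real
  assumes "\<bar>x\<bar> \<le> 1"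
  shows "exp x \<le> 1 + x + x\<^sup>2"
proof (cases "x \<ge> 0")
  case True
  then show ?thesis using assms exp_bound[of x] by simp
next
  case False
  define y where "y = - x"
  have y: "0 < y" "y \<le> 1" using False assms by (auto simp: y_def)
  have "exp x = 1 / exp y" by (simp add: y_def exp_minus field_simps)
  also have "\<dots> \<le> 1 / (1 + y)"
    using y exp_ge_add_one_self[of y] by (intro divide_left_mono) auto
  also have "\<dots> \<le> 1 - y + y\<^sup>2"
  proof -
    have "(1 - y + y\<^sup>2) * (1 + y) = 1 + y ^ 3" by (simp add: algebra_simps power2_eq_square power3_eq_cube)
    then show ?thesis using y by (simp add: pos_divide_le_eq)
  qed
  finally show ?thesis by (simp add: y_def)
qed

lemma prob_geometric_half_atLeast:
  "measure_pmf.prob (geometric_pmf (1 / 2)) {l..} = 1 / 2 ^ l"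
proof -
  have "measure_pmf.prob (geometric_pmf (1 / 2)) {..<l} = (\<Sum>i<l. (1 / 2) ^ i * (1 / 2))"
    by (subst measure_measure_pmf_finite) auto
  also have "\<dots> = 1 - 1 / 2 ^ l"
    by (induction l) (auto simp: power_divide field_simps)
  finally have "measure_pmf.prob (geometric_pmf (1 / 2)) {..<l} = 1 - 1 / 2 ^ l" .
  moreover have "{l..} = UNIV - {..<l}" by auto
  ultimately show ?thesis
    using measure_pmf.prob_compl[of "{..<l}" "geometric_pmf (1 / 2)"] by simp
qed

definition hash_pmf :: "nat \<Rightarrow> (nat \<Rightarrow> nat) pmf" where
  "hash_pmf n = Pi_pmf {..<n} 0 (\<lambda>_. geometric_pmf (1 / 2))"

text \<open>Only the values \<open>f 0\<close>, ..., \<open>f (card W)\<close> can occur, so the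
  function is bounded.\<close>

lemma integrable_hash_card:
  fixes f :: "nat \<Rightarrow> real"
  assumes "finite W"
  shows "integrable (measure_pmf M) (\<lambda>h. f (card (W \<inter> A h)))"
proof (rule measure_pmf.integrable_const_bound[where B = "\<Sum>j\<le>card W. \<bar>f j\<bar>"])
  have "\<bar>f (card (W \<inter> A h))\<bar> \<le> (\<Sum>j\<le>card W. \<bar>f j\<bar>)" for h
    using assms by (intro member_le_sum) (auto intro: card_mono)
  then show "AE h in measure_pmf M. norm (f (card (W \<inter> A h))) \<le> (\<Sum>j\<le>card W. \<bar>f j\<bar>)"
    by simp
qed simp

text \<open>The events \<open>l \<le> h i\<close> are independent with probability
  \<open>1 / 2 ^ l\<close>, so the moment generating function is a product over \<open>W\<close>;
  \<open>1 + z \<le> exp z\<close> bounds it by that of a Poisson variable of the same mean.\<close>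

lemma mgf_hash_card:
  assumes W: "W \<subseteq> {..<n}"
  shows "measure_pmf.expectation (hash_pmf n) (\<lambda>h. exp (x * real (card (W \<inter> {i. l \<le> h i}))))
           \<le> exp (real (card W) / 2 ^ l * (exp x - 1))"
proof -
  have fin: "finite W" using W finite_subset by auto
  define f :: "nat \<Rightarrow> nat \<Rightarrow> real" where "f i v = (if i \<in> W \<and> l \<le> v then exp x else 1)" for i v
  have f_alt: "f i v = 1 + (if i \<in> W then exp x - 1 else 0) * indicator {l..} v" for i v
    by (simp add: f_def)
  have prod: "exp (x * real (card (W \<inter> {i. l \<le> h i}))) = (\<Prod>i<n. f i (h i))" for h
  proof -
    have "(\<Prod>i<n. f i (h i)) = (\<Prod>i\<in>W \<inter> {i. l \<le> h i}. exp x)"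
      using W by (intro prod.mono_neutral_cong_right) (auto simp: f_def)
    then show ?thesis by (simp add: exp_of_nat2_mult)
  qed
  have Ef: "measure_pmf.expectation (geometric_pmf (1 / 2)) (f i) =
      (if i \<in> W then 1 + (exp x - 1) / 2 ^ l else 1)" for i
    unfolding f_alt
    by (subst Bochner_Integration.integral_add)
      (auto simp: prob_geometric_half_atLeast measure_pmf.integrable_const_bound[where B = 1])
  have "measure_pmf.expectation (hash_pmf n) (\<lambda>h. exp (x * real (card (W \<inter> {i. l \<le> h i}))))
      = (\<Prod>i<n. measure_pmf.expectation (geometric_pmf (1 / 2)) (f i))"
    unfolding prod hash_pmf_def
  proof (rule expectation_prod_Pi_pmf)
    show "integrable (measure_pmf (geometric_pmf (1 / 2))) (f i)" for i
      by (rule measure_pmf.integrable_const_bound[where B = "exp x + 1"]) (auto simp: f_def)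
  qed (auto simp: f_def)
  also have "\<dots> = (\<Prod>i\<in>W. 1 + (exp x - 1) / 2 ^ l)"
    unfolding Ef using W by (intro prod.mono_neutral_cong_right) auto
  also have "\<dots> = (1 + (exp x - 1) / 2 ^ l) ^ card W" by simp
  also have "\<dots> \<le> exp ((exp x - 1) / 2 ^ l) ^ card W"
  proof (rule power_mono)
    \<comment> \<open>The base is a convex combination of 1 and \<open>exp x\<close>, hence
      nonnegative for negative \<open>x\<close> as well.\<close>
    have "1 / 2 ^ l \<le> (1 :: real)" by simp
    then have "(1 - exp x) / 2 ^ l \<le> 1"
      by (cases "x \<ge> 0") (auto simp: divide_le_eq intro: order_trans[of _ 0] order_trans[of _ 1])
    then show "0 \<le> 1 + (exp x - 1) / 2 ^ l" by (simp add: field_simps)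
  qed (use exp_ge_add_one_self in auto)
  also have "\<dots> = exp (real (card W) / 2 ^ l * (exp x - 1))"
    by (simp flip: exp_of_nat_mult)
  finally show ?thesis .
qed

text \<open>Two-sided Chernoff bound. The scale \<open>M\<close> is only an upper bound on the mean,
  because the error allowed for the new items is measured by the size of \<open>U\<close>, which may
  far exceed that of \<open>W\<close>.\<close>

lemma hash_card_deviation:
  assumes W: "W \<subseteq> {..<n}" and M: "real (card W) / 2 ^ l \<le> M" and x: "0 < x" "x \<le> 1"
  shows "measure_pmf.prob (hash_pmf n)
      {h. \<bar>real (card (W \<inter> {i. l \<le> h i})) - real (card W) / 2 ^ l\<bar> > x * M} \<le> 2 * exp (- (x\<^sup>2 * M / 4))"
    (is "measure_pmf.prob _ ?A \<le> _")
proof -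
  have fin: "finite W" using W finite_subset by auto
  define X where "X h = real (card (W \<inter> {i. l \<le> h i}))" for h
  define mu where "mu = real (card W) / 2 ^ l"
  have mu: "0 \<le> mu" "mu \<le> M" using M by (auto simp: mu_def)
  have int: "integrable (measure_pmf (hash_pmf n)) (\<lambda>h. exp (y * X h))" for y
    unfolding X_def by (rule integrable_hash_card[OF fin])
  have centred: "exp (- y * mu) * measure_pmf.expectation (hash_pmf n) (\<lambda>h. exp (y * X h)) \<le> exp (M * y\<^sup>2)"
    if "\<bar>y\<bar> \<le> 1" for y
  proof -
    have "exp (- y * mu) * measure_pmf.expectation (hash_pmf n) (\<lambda>h. exp (y * X h))
        \<le> exp (- y * mu) * exp (mu * (exp y - 1))"
      using mgf_hash_card[OF W] by (intro mult_left_mono) (auto simp: X_def mu_def)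
    also have "\<dots> = exp (mu * (exp y - 1 - y))" by (simp flip: exp_add add: algebra_simps)
    also have "mu * (exp y - 1 - y) \<le> M * y\<^sup>2"
      using mu exp_le_quadratic[OF that] by (intro mult_mono') (auto simp: algebra_simps)
    finally show ?thesis by simp
  qed
  \<comment> \<open>This choice minimises the final exponent
    \<open>M * y\<^sup>2 - y * (x * M)\<close>.\<close>
  define y where "y = x / 2"
  let ?c = "exp (- (y * (x * M)))"
  have y: "0 < y" "\<bar>y\<bar> \<le> 1" "\<bar>- y\<bar> \<le> 1" using x by (auto simp: y_def)
  \<comment> \<open>One exponential Markov term per tail; their sum dominates the indicator
    pointwise.\<close>
  let ?F = "\<lambda>h. ?c * exp (- y * mu) * exp (y * X h) + ?c * exp (- (- y) * mu) * exp (- y * X h)"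
  have "measure_pmf.prob (hash_pmf n) ?A = measure_pmf.expectation (hash_pmf n) (indicator ?A)" by simp
  also have "\<dots> \<le> measure_pmf.expectation (hash_pmf n) ?F"
  proof (rule integral_mono)
    show "integrable (measure_pmf (hash_pmf n)) ?F"
      by (intro Bochner_Integration.integrable_add integrable_mult_right int)
    show "integrable (measure_pmf (hash_pmf n)) (indicator ?A :: _ \<Rightarrow> real)"
      by (rule measure_pmf.integrable_const_bound[where B = 1]) auto
    fix h
    show "indicator ?A h \<le> ?F h"
    proof (cases "h \<in> ?A")
      case True
      then have "x * M \<le> X h - mu \<or> x * M \<le> mu - X h" by (auto simp: X_def mu_def abs_if split: if_splits)
      then have "y * (x * M) \<le> y * (X h - mu) \<or> y * (x * M) \<le> y * (mu - X h)"
        using y(1) mult_le_cancel_left_pos by blast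
      then have "1 \<le> exp (- (y * (x * M)) + - y * mu + y * X h) \<or>
          1 \<le> exp (- (y * (x * M)) + - (- y) * mu + - y * X h)"
        by (simp add: algebra_simps)
      then have "1 \<le> ?c * exp (- y * mu) * exp (y * X h) \<or>
          1 \<le> ?c * exp (- (- y) * mu) * exp (- y * X h)"
        by (simp only: exp_add)
      moreover have "0 \<le> ?c * exp (- y * mu) * exp (y * X h)"
        "0 \<le> ?c * exp (- (- y) * mu) * exp (- y * X h)" by simp_all
      ultimately show ?thesis using True by (simp only: indicator_simps) linarith
    qed simp
  qed
  also have "\<dots> = ?c * (exp (- y * mu) * measure_pmf.expectation (hash_pmf n) (\<lambda>h. exp (y * X h))) +
      ?c * (exp (- (- y) * mu) * measure_pmf.expectation (hash_pmf n) (\<lambda>h. exp (- y * X h)))"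
    by (subst Bochner_Integration.integral_add)
      (simp_all only: integrable_mult_right int integral_mult_right_zero mult.assoc)
  also have "\<dots> \<le> ?c * exp (M * y\<^sup>2) + ?c * exp (M * (- y)\<^sup>2)"
    using y by (intro add_mono mult_left_mono centred) auto
  also have "\<dots> = 2 * exp (- (y * (x * M)) + M * y\<^sup>2)" unfolding exp_add by simp
  also have "- (y * (x * M)) + M * y\<^sup>2 = - (x\<^sup>2 * M / 4)"
    by (simp add: y_def power2_eq_square field_simps)
  finally show ?thesis .
qed

section \<open>Small families of hash functions\<close>

text \<open>Newman's derandomisation: independent draws from \<open>M\<close> form such a family with positive
  probability, because the moment generating function of the number of bad draws is small.\<close>

lemma ex_small_family:
  fixes bad :: "'e \<Rightarrow> 'a \<Rightarrow> bool" and M :: "'a pmf"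
  assumes fin: "finite E" and p: "\<And>e. e \<in> E \<Longrightarrow> measure_pmf.prob M {x. bad e x} \<le> q / 4"
    and E: "real (card E) < 2 powr (q * real N / 2)" and q: "0 \<le> q"
  shows "\<exists>h. \<forall>e\<in>E. real (card {r. r < N \<and> bad e (h r)}) \<le> q * real N"
proof -
  define PM where "PM = Pi_pmf {..<N} undefined (\<lambda>_. M)"
  \<comment> \<open>With weight 2 for a bad draw, the product over the draws is an exponential
    moment of the number of bad draws.\<close>
  define f :: "'e \<Rightarrow> 'a \<Rightarrow> real" where "f e x = (if bad e x then 2 else 1)" for e x
  have f_alt: "f e x = 1 + indicator {x. bad e x} x" for e x by (simp add: f_def)
  have prod: "(\<Prod>r<N. f e (h r)) = 2 ^ card {r. r < N \<and> bad e (h r)}" for e h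
  proof -
    have "(\<Prod>r<N. f e (h r)) = (\<Prod>r\<in>{r. r < N \<and> bad e (h r)}. 2)"
      by (intro prod.mono_neutral_cong_right) (auto simp: f_def)
    then show ?thesis by simp
  qed
  have intf: "integrable (measure_pmf M) (f e)" for e
    by (rule measure_pmf.integrable_const_bound[where B = 2]) (auto simp: f_def)
  have le: "(2 :: real) ^ card {r. r < N \<and> bad e (h r)} \<le> 2 ^ N" for e h
  proof (rule power_increasing)
    show "card {r. r < N \<and> bad e (h r)} \<le> N"
      using card_mono[of "{..<N}" "{r. r < N \<and> bad e (h r)}"] by auto
  qed simp
  have int: "integrable (measure_pmf PM) (\<lambda>h. \<Prod>r<N. f e (h r))" for e
    unfolding prod using le by (intro measure_pmf.integrable_const_bound[where B = "2 ^ N"]) auto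
  have bound: "measure_pmf.expectation PM (\<lambda>h. \<Prod>r<N. f e (h r)) \<le> 2 powr (q * real N / 2)"
    if "e \<in> E" for e
  proof -
    have "measure_pmf.expectation PM (\<lambda>h. \<Prod>r<N. f e (h r)) = (\<Prod>r<N. measure_pmf.expectation M (f e))"
      unfolding PM_def by (rule expectation_prod_Pi_pmf) (simp_all add: intf, simp add: f_def)
    also have "measure_pmf.expectation M (f e) = 1 + measure_pmf.prob M {x. bad e x}"
      unfolding f_alt
      by (subst Bochner_Integration.integral_add)
        (auto simp: measure_pmf.integrable_const_bound[where B = 1])
    also have "(\<Prod>r<N. 1 + measure_pmf.prob M {x. bad e x}) \<le> (\<Prod>r<N. exp (q / 4))"
    proof (intro prod_mono conjI)
      show "1 + measure_pmf.prob M {x. bad e x} \<le> exp (q / 4)"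
        using p[OF that] exp_ge_add_one_self[of "q / 4"] by linarith
    qed simp
    \<comment> \<open>The exponent is rewritten so that the crude bound
      \<open>exp (1 / 2) \<le> 2\<close> leads to base 2, in which the size of \<open>E\<close> is
      measured.\<close>
    also have "\<dots> = exp (1 / 2) powr (q * real N / 2)"
      by (simp add: powr_def flip: exp_of_nat_mult)
    also have "exp (1 / 2 :: real) \<le> 2" using exp_bound_half[of "1 / 2 :: real"] by simp
    then have "exp (1 / 2) powr (q * real N / 2) \<le> 2 powr (q * real N / 2)"
      using q by (intro powr_mono2) auto
    finally show ?thesis .
  qed
  \<comment> \<open>Summing the moments over \<open>E\<close> lets one draw serve all events: if the
    sum is below \<open>2 powr (q * real N)\<close>, so is each of its nonnegative terms.\<close>
  have "\<exists>h. (\<Sum>e\<in>E. \<Prod>r<N. f e (h r)) < 2 powr (q * real N)"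
  proof (rule ccontr)
    assume "\<not> ?thesis"
    then have "2 powr (q * real N) \<le> (\<Sum>e\<in>E. \<Prod>r<N. f e (h r))" for h by (simp add: not_less)
    then have "2 powr (q * real N) \<le> measure_pmf.expectation PM (\<lambda>h. \<Sum>e\<in>E. \<Prod>r<N. f e (h r))"
      using int by (intro measure_pmf.integral_ge_const) auto
    also have "\<dots> = (\<Sum>e\<in>E. measure_pmf.expectation PM (\<lambda>h. \<Prod>r<N. f e (h r)))"
      using int by (intro Bochner_Integration.integral_sum) auto
    also have "\<dots> \<le> (\<Sum>e\<in>E. 2 powr (q * real N / 2))" by (intro sum_mono bound)
    also have "\<dots> = real (card E) * 2 powr (q * real N / 2)" by simp
    also have "\<dots> < 2 powr (q * real N / 2) * 2 powr (q * real N / 2)"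
      using E by (intro mult_strict_right_mono) auto
    also have "\<dots> = 2 powr (q * real N)" by (simp flip: powr_add)
    finally show False by simp
  qed
  then obtain h where h: "(\<Sum>e\<in>E. \<Prod>r<N. f e (h r)) < 2 powr (q * real N)" by blast
  have "real (card {r. r < N \<and> bad e (h r)}) \<le> q * real N" if "e \<in> E" for e
  proof -
    have "(\<Prod>r<N. f e (h r)) \<le> (\<Sum>e\<in>E. \<Prod>r<N. f e (h r))"
      using that fin by (intro member_le_sum) (auto simp: f_def intro!: prod_nonneg)
    then have "2 powr real (card {r. r < N \<and> bad e (h r)}) < 2 powr (q * real N)"
      using h by (simp add: prod powr_realpow)
    then show ?thesis by simp
  qed
  then show ?thesis by blast
qed

section \<open>Bad hashes and the choice of the sampling level\<close>

text \<open>The sampling level used by the protocol is, for a hash that is not bad, always one at which the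
  expected sample of \<open>U\<close> exceeds \<open>cap / 4\<close> (or level 0, where there is no error), so nothing is
  required of the other levels.\<close>

definition bad_hash ::
    "nat \<Rightarrow> real \<Rightarrow> real \<Rightarrow> nat set \<Rightarrow> nat set \<Rightarrow> nat \<Rightarrow> (nat \<Rightarrow> nat) \<Rightarrow> bool" where
  "bad_hash cap \<gamma> \<epsilon> U W l h \<longleftrightarrow>
     real cap / 4 < real (card U) / 2 ^ l \<and>
     (\<bar>real (card (U \<inter> {i. l \<le> h i})) - real (card U) / 2 ^ l\<bar> > 1 / 2 * (real (card U) / 2 ^ l) \<or>
      real (card W) \<le> \<gamma> * real (card U) \<and>
      \<bar>real (card (W \<inter> {i. l \<le> h i})) - real (card W) / 2 ^ l\<bar> > \<epsilon> * (real (card U) / 2 ^ l))"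

text \<open>With \<open>m\<close> the mean sample of \<open>U\<close>, \<open>cap / 4 < m\<close>
  yields \<open>m \<ge> 16 * c * (\<gamma> / \<epsilon>\<^sup>2)\<close>. The Chernoff bound is
  applied to \<open>U\<close> with relative error 1/2, giving exponent \<open>m / 16\<close>, and to
  \<open>W\<close> with relative error \<open>\<epsilon> / \<gamma>\<close> on the scale
  \<open>\<gamma> * m\<close>, giving exponent
  \<open>\<epsilon>\<^sup>2 * m / (4 * \<gamma>)\<close>. Both are at least \<open>c\<close>, since
  \<open>\<gamma> / \<epsilon>\<^sup>2 \<ge> 1\<close>.\<close>

lemma prob_bad_hash:
  assumes UW: "U \<subseteq> {..<n}" "W \<subseteq> {..<n}" and e: "0 < \<epsilon>" "\<epsilon> < 1" "\<epsilon> < \<gamma>"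
    and cap: "64 * c * (\<gamma> / \<epsilon>\<^sup>2) \<le> real cap" and c: "0 \<le> c"
  shows "measure_pmf.prob (hash_pmf n) {h. bad_hash cap \<gamma> \<epsilon> U W l h} \<le> 4 * exp (- c)"
proof (cases "real cap / 4 < real (card U) / 2 ^ l")
  case False
  then show ?thesis by (simp add: bad_hash_def)
next
  case True
  define m where "m = real (card U) / 2 ^ l"
  have m: "16 * c * (\<gamma> / \<epsilon>\<^sup>2) \<le> m" 
  proof -
    have "real cap / 4 < m" using True by (simp add: m_def)
    then show ?thesis using cap by linarith
  qed
  have "\<epsilon>\<^sup>2 \<le> \<epsilon> * 1" unfolding power2_eq_square using e by (intro mult_left_mono) auto
  then have "1 \<le> \<gamma> / \<epsilon>\<^sup>2" using e by (simp add: le_divide_eq)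
  then have "16 * c * 1 \<le> 16 * c * (\<gamma> / \<epsilon>\<^sup>2)" using c by (intro mult_left_mono) auto
  then have m16: "16 * c \<le> m" using m by simp
  let ?A = "{h. \<bar>real (card (U \<inter> {i. l \<le> h i})) - real (card U) / 2 ^ l\<bar> > 1 / 2 * m}"
  let ?B = "{h. \<bar>real (card (W \<inter> {i. l \<le> h i})) - real (card W) / 2 ^ l\<bar> > \<epsilon> / \<gamma> * (\<gamma> * m)}"
  have A: "measure_pmf.prob (hash_pmf n) ?A \<le> 2 * exp (- c)"
  proof -
    have "measure_pmf.prob (hash_pmf n) ?A \<le> 2 * exp (- ((1 / 2)\<^sup>2 * m / 4))"
      by (rule hash_card_deviation[OF UW(1)]) (auto simp: m_def)
    also have "\<dots> \<le> 2 * exp (- c)" using m16 by (simp add: power2_eq_square)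
    finally show ?thesis .
  qed
  have B: "measure_pmf.prob (hash_pmf n) ?B \<le> 2 * exp (- c)" if "real (card W) \<le> \<gamma> * real (card U)"
  proof -
    have "measure_pmf.prob (hash_pmf n) ?B \<le> 2 * exp (- ((\<epsilon> / \<gamma>)\<^sup>2 * (\<gamma> * m) / 4))"
      using that e by (intro hash_card_deviation[OF UW(2)]) (auto simp: m_def divide_right_mono)
    also have "c \<le> (\<epsilon> / \<gamma>)\<^sup>2 * (\<gamma> * m) / 4"
    proof -
      have "16 * c = (\<epsilon> / \<gamma>)\<^sup>2 * \<gamma> * (16 * c * (\<gamma> / \<epsilon>\<^sup>2))"
        using e by (simp add: power2_eq_square field_simps)
      also have "\<dots> \<le> (\<epsilon> / \<gamma>)\<^sup>2 * \<gamma> * m" using m e by (intro mult_left_mono) auto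
      finally show ?thesis using c by (simp add: mult.assoc)
    qed
    then have "2 * exp (- ((\<epsilon> / \<gamma>)\<^sup>2 * (\<gamma> * m) / 4)) \<le> 2 * exp (- c)" by simp
    finally show ?thesis .
  qed
  have eq: "\<epsilon> / \<gamma> * (\<gamma> * m) = \<epsilon> * m" using e by simp
  show ?thesis
  proof (cases "real (card W) \<le> \<gamma> * real (card U)")
    case W: True
    have "measure_pmf.prob (hash_pmf n) {h. bad_hash cap \<gamma> \<epsilon> U W l h} \<le>
        measure_pmf.prob (hash_pmf n) (?A \<union> ?B)"
      unfolding eq by (intro measure_pmf.finite_measure_mono) (auto simp: bad_hash_def m_def)
    also have "\<dots> \<le> measure_pmf.prob (hash_pmf n) ?A + measure_pmf.prob (hash_pmf n) ?B"
      by (rule measure_Un_le) auto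
    finally show ?thesis using A B[OF W] by simp
  next
    case False
    have "measure_pmf.prob (hash_pmf n) {h. bad_hash cap \<gamma> \<epsilon> U W l h} \<le> measure_pmf.prob (hash_pmf n) ?A"
      using False by (intro measure_pmf.finite_measure_mono) (auto simp: bad_hash_def m_def)
    also note A
    finally show ?thesis by (rule order_trans) simp
  qed
qed

text \<open>The level \<open>l\<close> depends on the hash, so concentration is used at every level
  up to a level \<open>l0\<close> that does not. At \<open>l0\<close> the mean sample of
  \<open>U\<close> is at most \<open>cap / 2\<close>, so the actual one fits into \<open>cap\<close>
  and \<open>l \<le> l0\<close>; all means up to \<open>l0\<close> exceed \<open>cap / 4\<close>, so
  there the hash is accurate. The second claim keeps the cutoff of the protocol from being
  reached.\<close>

lemma good_hash_level:
  assumes UW: "U \<subseteq> {..<n}" "W \<subseteq> {..<n}" and e: "0 < \<epsilon>" "\<epsilon> < \<gamma>"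
    and W: "real (card W) \<le> \<gamma> * real (card U)" and n: "n \<le> 2 ^ L" and cap: "2 \<le> cap"
    and good: "\<And>l. l \<le> L \<Longrightarrow> \<not> bad_hash cap \<gamma> \<epsilon> U W l h"
  defines "l \<equiv> LEAST l. card (U \<inter> {i. l \<le> h i}) \<le> cap"
  shows "\<bar>2 ^ l * real (card (W \<inter> {i. l \<le> h i})) - real (card W)\<bar> \<le> \<epsilon> * real (card U)"
    and "real (card (W \<inter> {i. l \<le> h i})) \<le> 4 * \<gamma> * real cap"
proof -
  have "\<bar>2 ^ l * real (card (W \<inter> {i. l \<le> h i})) - real (card W)\<bar> \<le> \<epsilon> * real (card U) \<and>
      real (card (W \<inter> {i. l \<le> h i})) \<le> 4 * \<gamma> * real cap"
  proof (cases "card U \<le> cap")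
    case True
    then have "l = 0" unfolding l_def by (intro Least_equality) auto
    moreover have "\<gamma> * real (card U) \<le> \<gamma> * real cap" using True e by (intro mult_left_mono) auto
    moreover have "0 \<le> \<gamma> * real cap" using e by simp
    moreover have "real (card W) \<le> 4 * \<gamma> * real cap" using W calculation by linarith
    ultimately show ?thesis using e by simp
  next
    case False
    define m where "m l = real (card U) / 2 ^ l" for l
    define l0 where "l0 = (LEAST l. m l \<le> real cap / 2)"
    have "card U \<le> n" using card_mono[OF _ UW(1)] by simp
    then have "card U \<le> 2 ^ L" using n by simp
    then have "real (card U) \<le> 2 ^ L" by (metis of_nat_le_iff of_nat_numeral of_nat_power)
    then have "m L \<le> 1" by (simp add: m_def)
    then have mL: "m L \<le> real cap / 2" using cap by simp
    have l0: "m l0 \<le> real cap / 2" "l0 \<le> L"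
      unfolding l0_def by (rule LeastI[of "\<lambda>l. m l \<le> real cap / 2", OF mL],
        rule Least_le[of "\<lambda>l. m l \<le> real cap / 2", OF mL])
    have "l0 \<noteq> 0" using l0(1) False by (intro notI) (simp add: m_def)
    \<comment> \<open>The level before \<open>l0\<close> has mean above \<open>cap / 2\<close>, and
      one level further the mean is halved.\<close>
    then obtain l1 where l1: "l0 = Suc l1" using not0_implies_Suc by blast
    then have "\<not> m l1 \<le> real cap / 2" unfolding l0_def by (metis lessI not_less_Least)
    then have "real cap / 4 < m l0" by (simp add: l1 m_def not_le mult.commute)
    moreover have m_mono: "m l0 \<le> m l'" if "l' \<le> l0" for l'
      unfolding m_def using that by (intro divide_left_mono power_increasing) auto
    ultimately have big: "real cap / 4 < m l'" if "l' \<le> l0" for l' using that by fastforce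
    have g: "\<bar>real (card (U \<inter> {i. l' \<le> h i})) - m l'\<bar> \<le> 1 / 2 * m l'"
      "\<bar>real (card (W \<inter> {i. l' \<le> h i})) - real (card W) / 2 ^ l'\<bar> \<le> \<epsilon> * m l'"
      if "l' \<le> l0" for l'
      using good[of l'] big[OF that] that l0(2) W by (auto simp: bad_hash_def m_def)
    have "real (card (U \<inter> {i. l0 \<le> h i})) \<le> real cap" using g(1)[of l0] l0(1) by (simp add: abs_if split: if_splits)
    then have le: "card (U \<inter> {i. l0 \<le> h i}) \<le> cap" by simp
    have l: "l \<le> l0" "card (U \<inter> {i. l \<le> h i}) \<le> cap"
      unfolding l_def by (rule Least_le[of "\<lambda>l. card (U \<inter> {i. l \<le> h i}) \<le> cap", OF le],
        rule LeastI[of "\<lambda>l. card (U \<inter> {i. l \<le> h i}) \<le> cap", OF le])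
    \<comment> \<open>The sample at level \<open>l\<close> has at most \<open>cap\<close> items and
      at least half of its mean.\<close>
    have m2: "m l \<le> 2 * real cap" using g(1)[OF l(1)] l(2) by linarith
    have "real (card (W \<inter> {i. l \<le> h i})) \<le> real (card W) / 2 ^ l + \<epsilon> * m l" using g(2)[OF l(1)] by linarith
    also have "real (card W) / 2 ^ l \<le> \<gamma> * m l" using W by (simp add: m_def divide_right_mono)
    also have "\<epsilon> * m l \<le> \<gamma> * m l" using e by (intro mult_right_mono) (auto simp: m_def)
    also have "\<gamma> * m l + \<gamma> * m l \<le> 4 * \<gamma> * real cap"
      using mult_left_mono[OF m2, of \<gamma>] e by simp
    finally have 1: "real (card (W \<inter> {i. l \<le> h i})) \<le> 4 * \<gamma> * real cap" by simp
    have "2 ^ l * real (card (W \<inter> {i. l \<le> h i})) - real (card W) =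
        2 ^ l * (real (card (W \<inter> {i. l \<le> h i})) - real (card W) / 2 ^ l)"
      by (simp add: right_diff_distrib)
    then have "\<bar>2 ^ l * real (card (W \<inter> {i. l \<le> h i})) - real (card W)\<bar> =
        2 ^ l * \<bar>real (card (W \<inter> {i. l \<le> h i})) - real (card W) / 2 ^ l\<bar>"
      by (simp add: abs_mult)
    also have "\<dots> \<le> 2 ^ l * (\<epsilon> * m l)" using g(2)[OF l(1)] by (intro mult_left_mono) auto
    also have "\<dots> = \<epsilon> * real (card U)" by (simp add: m_def)
    finally show ?thesis using 1 by simp
  qed
  then show "\<bar>2 ^ l * real (card (W \<inter> {i. l \<le> h i})) - real (card W)\<bar> \<le> \<epsilon> * real (card U)"
    and "real (card (W \<inter> {i. l \<le> h i})) \<le> 4 * \<gamma> * real cap" by auto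
qed

section \<open>The sampling protocol\<close>

definition items :: "server_obs list \<Rightarrow> nat set" where
  "items h = {i. Item i \<in> set h}"

fun coord_msgs :: "server_obs list \<Rightarrow> msg list" where
  "coord_msgs [] = []"
| "coord_msgs (Item i # h) = coord_msgs h"
| "coord_msgs (From_Coord m # h) = m # coord_msgs h"

lemma items_simps [simp]:
  "items [] = {}" "items (Item i # h) = insert i (items h)"
  "items (From_Coord m # h) = items h" "items (h @ h') = items h \<union> items h'"
  by (auto simp: items_def)

lemma items_map_Item [simp]: "items (map Item xs) = set xs"
  by (auto simp: items_def)

lemma coord_msgs_append [simp]: "coord_msgs (h @ h') = coord_msgs h @ coord_msgs h'"
  by (induction h rule: coord_msgs.induct) auto

lemma coord_msgs_map_Item [simp]: "coord_msgs (map Item xs) = []"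
  by (induction xs) auto

definition arrivals :: "stream \<Rightarrow> event list" where
  "arrivals s = map (\<lambda>(j, i). Arrival j i) s"

definition local_items :: "nat \<Rightarrow> stream \<Rightarrow> nat list" where
  "local_items j s = map snd (filter (\<lambda>(j', i). j' = j) s)"

lemma local_items_simps [simp]:
  "local_items j [] = []"
  "local_items j (s @ [(j', i)]) = local_items j s @ (if j' = j then [i] else [])"
  by (auto simp: local_items_def)

lemma local_items_append: "local_items j (s @ s') = local_items j s @ local_items j s'"
  by (simp add: local_items_def)

lemma sum_Suc_at:
  fixes f f' :: "nat \<Rightarrow> nat"
  assumes "j < k" "f' j = Suc (f j)" "\<And>j'. j' \<noteq> j \<Longrightarrow> f' j' = f j'"
  shows "(\<Sum>j<k. f' j) = Suc (\<Sum>j<k. f j)"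
proof -
  have "(\<Sum>j<k. f' j) = f' j + (\<Sum>j\<in>{..<k} - {j}. f' j)"
    using assms(1) by (intro sum.remove) auto
  also have "(\<Sum>j\<in>{..<k} - {j}. f' j) = (\<Sum>j\<in>{..<k} - {j}. f j)"
    using assms(3) by (intro sum.cong) auto
  also have "f' j + \<dots> = Suc (\<Sum>j<k. f j)"
    using assms(1,2) by (subst sum.remove[of "{..<k}" j]) auto
  finally show ?thesis .
qed

lemma Union_local_items:
  assumes "valid_stream n k s"
  shows "(\<Union>j<k. set (local_items j s)) = snd ` set s"
  using assms by (force simp: valid_stream_def local_items_def)

lemma run_events_append:
  "run_events P R (es @ es') c = Option.bind (run_events P R es c) (run_events P R es')"
  by (induction es arbitrary: c) (auto simp: bind_assoc split: Option.bind_split)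

lemma settle_idle: "pending c = [] \<Longrightarrow> settle P R c = Some c"
  unfolding settle_def by (subst while_option_unfold) simp

lemma settle_step:
  "pending c = p # ps \<Longrightarrow> settle P R c = settle P R (deliver P R p (c\<lparr>pending := ps\<rparr>))"
  unfolding settle_def by (subst while_option_unfold) simp

text \<open>\<open>g r\<close> is the hash with seed \<open>r\<close>, and \<open>lim\<close> is the
  cutoff for the items a server forwards. The codes are arbitrary injections with words of constant
  length, so the communication depends only on the number of messages of each kind.\<close>

locale sampling_protocol =
  fixes n k L cap lim N :: nat and g :: "nat \<Rightarrow> nat \<Rightarrow> nat"
    and seed_code level_code item_code :: "nat \<Rightarrow> msg" and reply_code :: "nat \<times> nat set \<Rightarrow> msg"
    and seed_bits level_bits item_bits reply_bits :: nat
  assumes k_pos: "0 < k"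
    and g_le: "g r i \<le> L"
    and seed_inj: "inj_on seed_code {..<N}" and seed_len: "length (seed_code r) = seed_bits"
    and level_inj: "inj_on level_code {..Suc L}" and level_len: "length (level_code l) = level_bits"
    and item_inj: "inj_on item_code {..<n}" and item_len: "length (item_code i) = item_bits"
    and reply_inj: "inj_on reply_code ({..Suc L} \<times> {A. A \<subseteq> {..<n} \<and> card A \<le> cap})"
    and reply_len: "length (reply_code q) = reply_bits"
    and bits_pos: "0 < seed_bits" "0 < level_bits" "0 < item_bits" "0 < reply_bits"
begin

definition sample :: "nat \<Rightarrow> nat \<Rightarrow> nat set" where
  "sample r l = {i. l \<le> g r i}"

definition level :: "nat \<Rightarrow> nat set \<Rightarrow> nat" where
  "level r A = (LEAST l. card (A \<inter> sample r l) \<le> cap)"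

definition reply :: "nat \<Rightarrow> nat set \<Rightarrow> nat \<times> nat set" where
  "reply r A = (level r A, A \<inter> sample r (level r A))"

text \<open>Below its own level a server has not reported its full sample, so only levels that are
  at least all reported ones are considered.\<close>

definition merged_level :: "nat \<Rightarrow> (nat \<times> nat set) list \<Rightarrow> nat" where
  "merged_level r qs =
     (LEAST l. (\<forall>q\<in>set qs. fst q \<le> l) \<and> card (\<Union>(snd ` set qs) \<inter> sample r l) \<le> cap)"

text \<open>A server recognises the phase by the number of messages from the coordinator: the first
  carries the seed, the second the level. The cutoff by \<open>lim\<close> bounds the communication
  even for a bad seed.\<close>

definition server_move :: "nat \<Rightarrow> nat \<Rightarrow> server_obs list \<Rightarrow> msg option" where
  "server_move j x h = (case last h of
     From_Coord m \<Rightarrow>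
       if length (coord_msgs h) = 1
       then Some (reply_code (reply (inv_into {..<N} seed_code m) (items h))) else None
   | Item i \<Rightarrow> (case coord_msgs h of
       [m, m'] \<Rightarrow>
         let S = sample (inv_into {..<N} seed_code m) (inv_into {..Suc L} level_code m')
         in if i \<in> S \<and> i \<notin> items (butlast h) \<and> card (items (butlast h) \<inter> S) < lim
            then Some (item_code i) else None
     | _ \<Rightarrow> None))"

text \<open>Position alone tells the kinds of observations apart: first comes \<open>Split\<close>,
  then the \<open>k\<close> replies, then forwarded items.\<close>

definition replies :: "coord_obs list \<Rightarrow> (nat \<times> nat set) list" where
  "replies h = map (\<lambda>ob. case ob of
       From_Server j m \<Rightarrow> inv_into ({..Suc L} \<times> {A. A \<subseteq> {..<n} \<and> card A \<le> cap}) reply_code m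
     | Split \<Rightarrow> undefined) (take k (tl h))"

definition coord_level :: "nat \<Rightarrow> coord_obs list \<Rightarrow> nat" where
  "coord_level r h = merged_level r (replies h)"

definition coord_move :: "nat \<Rightarrow> coord_obs list \<Rightarrow> (nat \<times> msg) list" where
  "coord_move r h =
     (if length h = 1 then map (\<lambda>j. (j, seed_code r)) [0..<k]
      else if length h = Suc k then map (\<lambda>j. (j, level_code (coord_level r h))) [0..<k]
      else [])"

definition received :: "coord_obs list \<Rightarrow> nat set" where
  "received h = {i. i < n \<and> (\<exists>j. From_Server j (item_code i) \<in> set (drop (Suc k) h))}"

text \<open>The old sample is subtracted because an item seen before the splitting time at one
  server may be new to another, which then forwards it.\<close>

definition estimate :: "nat \<Rightarrow> coord_obs list \<Rightarrow> real" where
  "estimate r h = 2 ^ coord_level r h *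
     real (card (received h - \<Union>(snd ` set (replies h)) \<inter> sample r (coord_level r h)))"

definition prot :: protocol where
  "prot = \<lparr>server_coins = (\<lambda>_. return_pmf 0), coord_coins = pmf_of_set {..<N},
     server_act = server_move, coord_act = coord_move, coord_out = estimate\<rparr>"

lemma prot_simps [simp]:
  "server_act prot = server_move" "coord_act prot = coord_move" "coord_out prot = estimate"
  "coord_coins prot = pmf_of_set {..<N}"
  by (simp_all add: prot_def)

lemma code_ne_Nil [simp]:
  "seed_code r \<noteq> []" "level_code l \<noteq> []" "item_code i \<noteq> []" "reply_code q \<noteq> []"
  using seed_len[of r] level_len[of l] item_len[of i] reply_len[of q] bits_pos by auto

lemma wf_prot: "wf_protocol k prot"
  unfolding wf_protocol_def
  by (auto simp: server_move_def coord_move_def Let_def split: server_obs.splits list.splits)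

section \<open>Least levels and the merging of replies\<close>

lemma sample_antimono: "l \<le> l' \<Longrightarrow> sample r l' \<subseteq> sample r l"
  by (auto simp: sample_def)

text \<open>The empty level \<open>Suc L\<close> is the witness that the least levels exist,
  whatever the set of items.\<close>

lemma sample_top [simp]: "sample r (Suc L) = {}"
  using g_le by (auto simp: sample_def Suc_le_eq not_less)

lemma level_le: "level r A \<le> Suc L"
  unfolding level_def by (rule Least_le) simp

lemma card_level: "card (A \<inter> sample r (level r A)) \<le> cap"
  unfolding level_def by (rule LeastI[of "\<lambda>l. card (A \<inter> sample r l) \<le> cap" "Suc L"]) simp

lemma level_leI: "card (A \<inter> sample r l) \<le> cap \<Longrightarrow> level r A \<le> l"
  unfolding level_def by (rule Least_le)

text \<open>At a level \<open>l\<close> above all local ones, \<open>sample r l\<close> lies inside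
  every reported sample, so the replies determine the global sample. Conversely, if the global
  sample at \<open>l\<close> fits into \<open>cap\<close>, so does each local one, and all local
  levels are at most \<open>l\<close>. Hence both least levels are taken over the same
  predicate.\<close>

lemma merged_level_reply:
  fixes r :: nat and A :: "nat \<Rightarrow> nat set"
  assumes "\<And>j. j < k \<Longrightarrow> finite (A j)"
  defines "qs \<equiv> map (\<lambda>j. reply r (A j)) [0..<k]"
  shows "merged_level r qs = level r (\<Union>j<k. A j)"
    and "\<Union>(snd ` set qs) \<inter> sample r (merged_level r qs)
           = (\<Union>j<k. A j) \<inter> sample r (level r (\<Union>j<k. A j))"
proof -
  have fin: "finite (\<Union>j<k. A j)" using assms(1) by auto
  have eq: "\<Union>(snd ` set qs) \<inter> sample r l = (\<Union>j<k. A j) \<inter> sample r l"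
    if "\<forall>q\<in>set qs. fst q \<le> l" for l
  proof -
    have "sample r l \<subseteq> sample r (level r (A j))" if "j < k" for j
      using \<open>\<forall>q\<in>set qs. fst q \<le> l\<close> that by (intro sample_antimono) (auto simp: qs_def reply_def)
    then show ?thesis by (fastforce simp: qs_def reply_def)
  qed
  have le: "\<forall>q\<in>set qs. fst q \<le> l" if "card ((\<Union>j<k. A j) \<inter> sample r l) \<le> cap" for l
  proof -
    have "level r (A j) \<le> l" if "j < k" for j
    proof (rule level_leI)
      have "card (A j \<inter> sample r l) \<le> card ((\<Union>j<k. A j) \<inter> sample r l)"
        using fin that by (intro card_mono) auto
      then show "card (A j \<inter> sample r l) \<le> cap"
        using \<open>card ((\<Union>j<k. A j) \<inter> sample r l) \<le> cap\<close> by simp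
    qed
    then show ?thesis by (auto simp: qs_def reply_def)
  qed
  have "((\<forall>q\<in>set qs. fst q \<le> l) \<and> card (\<Union>(snd ` set qs) \<inter> sample r l) \<le> cap)
          \<longleftrightarrow> card ((\<Union>j<k. A j) \<inter> sample r l) \<le> cap" for l
    using eq[of l] le[of l] by metis
  then show 1: "merged_level r qs = level r (\<Union>j<k. A j)"
    unfolding merged_level_def level_def by simp
  show "\<Union>(snd ` set qs) \<inter> sample r (merged_level r qs)
           = (\<Union>j<k. A j) \<inter> sample r (level r (\<Union>j<k. A j))"
    unfolding 1 by (rule eq, rule le, rule card_level)
qed

section \<open>Execution up to the splitting time\<close>

lemma run_before_split:
  "run_events prot R (arrivals s) init_config =
     Some \<lparr>server_view = (\<lambda>j. map Item (local_items j s)), coord_view = [], pending = [], bits = 0\<rparr>"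
proof (induction s rule: rev_induct)
  case Nil
  then show ?case by (simp add: arrivals_def init_config_def)
next
  case (snoc x s)
  obtain j i where x: "x = (j, i)" by (cases x)
  show ?case using snoc
    by (auto simp: arrivals_def run_events_append x server_observe_def send_def server_move_def
        Let_def settle_idle)
qed

definition first_reply :: "nat \<Rightarrow> stream \<Rightarrow> nat \<Rightarrow> msg" where
  "first_reply r s j = reply_code (reply r (set (local_items j s)))"

definition split_level :: "nat \<Rightarrow> stream \<Rightarrow> nat" where
  "split_level r s = level r (snd ` set s)"

definition reply_view :: "nat \<Rightarrow> stream \<Rightarrow> coord_obs list" where
  "reply_view r s = Split # map (\<lambda>j. From_Server j (first_reply r s j)) [0..<k]"

definition split_view :: "nat \<Rightarrow> stream \<Rightarrow> nat \<Rightarrow> server_obs list" where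
  "split_view r s j = map Item (local_items j s) @
     [From_Coord (seed_code r), From_Coord (level_code (split_level r s))]"

lemma replies_reply_view:
  assumes "valid_stream n k s"
  shows "replies (reply_view r s @ h) = map (\<lambda>j. reply r (set (local_items j s))) [0..<k]"
proof -
  have "set (local_items j s) \<subseteq> {..<n}" for j
    using assms by (auto simp: valid_stream_def local_items_def)
  then have "reply r (set (local_items j s)) \<in> {..Suc L} \<times> {A. A \<subseteq> {..<n} \<and> card A \<le> cap}" for j
    by (auto simp: reply_def level_le card_level)
  then show ?thesis
    by (simp add: replies_def reply_view_def first_reply_def inv_into_f_f[OF reply_inj])
qed

lemma coord_level_reply_view:
  assumes "valid_stream n k s"
  shows "coord_level r (reply_view r s @ h) = split_level r s"
    and "\<Union>(snd ` set (replies (reply_view r s @ h))) \<inter> sample r (split_level r s)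
           = snd ` set s \<inter> sample r (split_level r s)"
proof -
  note m = merged_level_reply[of "\<lambda>j. set (local_items j s)" r, simplified Union_local_items[OF assms]]
  show 1: "coord_level r (reply_view r s @ h) = split_level r s"
    unfolding coord_level_def replies_reply_view[OF assms] split_level_def
    by (rule m(1)) simp
  show "\<Union>(snd ` set (replies (reply_view r s @ h))) \<inter> sample r (split_level r s)
           = snd ` set s \<inter> sample r (split_level r s)"
    using m unfolding replies_reply_view[OF assms] split_level_def by simp
qed

text \<open>Delivery is first in, first out: after \<open>i\<close> deliveries the remaining seeds
  still precede the \<open>i\<close> replies produced so far.\<close>

lemma settle_seed_broadcast:
  assumes r: "r < N" and "i \<le> k"
  shows "settle prot R \<lparr>server_view = (\<lambda>j. map Item (local_items j s)), coord_view = [Split],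
             pending = map (\<lambda>j. To_Server j (seed_code r)) [0..<k], bits = B\<rparr> =
         settle prot R \<lparr>server_view = (\<lambda>j. map Item (local_items j s) @
               (if j < i then [From_Coord (seed_code r)] else [])),
             coord_view = [Split],
             pending = map (\<lambda>j. To_Server j (seed_code r)) [i..<k] @
               map (\<lambda>j. To_Coord j (first_reply r s j)) [0..<i],
             bits = B + i * reply_bits\<rparr>" (is "?lhs = settle prot R (?c i)")
  using \<open>i \<le> k\<close>
proof (induction i)
  case 0
  then show ?case by simp
next
  case (Suc i)
  then have "[i..<k] = i # [Suc i..<k]" by (simp add: upt_conv_Cons)
  then have "settle prot R (?c i) = settle prot R (deliver prot R (To_Server i (seed_code r))
      (?c i\<lparr>pending := map (\<lambda>j. To_Server j (seed_code r)) [Suc i..<k] @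
               map (\<lambda>j. To_Coord j (first_reply r s j)) [0..<i]\<rparr>))"
    by (intro settle_step) simp
  also have "deliver prot R (To_Server i (seed_code r))
      (?c i\<lparr>pending := map (\<lambda>j. To_Server j (seed_code r)) [Suc i..<k] @
               map (\<lambda>j. To_Coord j (first_reply r s j)) [0..<i]\<rparr>) = ?c (Suc i)"
    using r by (auto simp: server_observe_def send_def server_move_def Let_def first_reply_def
        reply_len inv_into_f_f[OF seed_inj] fun_eq_iff)
  finally show ?case using Suc by simp
qed

text \<open>The last reply is excluded by \<open>i < k\<close>, because its arrival triggers the
  broadcast of the level.\<close>

lemma settle_replies:
  assumes "i < k"
  shows "settle prot R \<lparr>server_view = V, coord_view = [Split],
             pending = map (\<lambda>j. To_Coord j (first_reply r s j)) [0..<k], bits = B\<rparr> =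
         settle prot R \<lparr>server_view = V,
             coord_view = Split # map (\<lambda>j. From_Server j (first_reply r s j)) [0..<i],
             pending = map (\<lambda>j. To_Coord j (first_reply r s j)) [i..<k], bits = B\<rparr>"
    (is "?lhs = settle prot R (?c i)")
  using assms
proof (induction i)
  case 0
  then show ?case by simp
next
  case (Suc i)
  then have "[i..<k] = i # [Suc i..<k]" by (simp add: upt_conv_Cons)
  then have "settle prot R (?c i) = settle prot R (deliver prot R (To_Coord i (first_reply r s i))
      (?c i\<lparr>pending := map (\<lambda>j. To_Coord j (first_reply r s j)) [Suc i..<k]\<rparr>))"
    by (intro settle_step) simp
  also have "deliver prot R (To_Coord i (first_reply r s i))
      (?c i\<lparr>pending := map (\<lambda>j. To_Coord j (first_reply r s j)) [Suc i..<k]\<rparr>) = ?c (Suc i)"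
    using Suc by (simp add: coord_observe_def send_def coord_move_def Let_def)
  finally show ?case using Suc by simp
qed

text \<open>With the last reply the view of the coordinator reaches length \<open>Suc k\<close>, at
  which it can compute the level and sends it.\<close>

lemma settle_all_replies:
  assumes "fst R = r" "valid_stream n k s"
  shows "settle prot R \<lparr>server_view = V, coord_view = [Split],
             pending = map (\<lambda>j. To_Coord j (first_reply r s j)) [0..<k], bits = B\<rparr> =
         settle prot R \<lparr>server_view = V, coord_view = reply_view r s,
             pending = map (\<lambda>j. To_Server j (level_code (split_level r s))) [0..<k],
             bits = B + k * level_bits\<rparr>" (is "_ = settle prot R ?d")
proof -
  obtain i where i: "k = Suc i" using k_pos gr0_implies_Suc by blast
  let ?c = "\<lparr>server_view = V,
             coord_view = Split # map (\<lambda>j. From_Server j (first_reply r s j)) [0..<i],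
             pending = [To_Coord i (first_reply r s i)], bits = B\<rparr>"
  have upt: "[0..<k] = [0..<i] @ [i]" "[i..<k] = [i]" by (simp_all add: i)
  have lv: "coord_level r (reply_view r s) = split_level r s"
    using coord_level_reply_view(1)[OF assms(2), of r "[]"] by simp
  have rv: "Split # map (\<lambda>j. From_Server j (first_reply r s j)) [0..<i] @
        [From_Server i (first_reply r s i)] = reply_view r s"
    by (simp add: reply_view_def upt)
  have act: "coord_move r (reply_view r s) = map (\<lambda>j. (j, level_code (split_level r s))) [0..<k]"
    using k_pos by (simp add: coord_move_def lv) (simp add: reply_view_def)
  have "settle prot R \<lparr>server_view = V, coord_view = [Split],
             pending = map (\<lambda>j. To_Coord j (first_reply r s j)) [0..<k], bits = B\<rparr> = settle prot R ?c"
    using settle_replies[of i R V r s B] by (simp only: upt list.map) (simp add: i)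
  also have "\<dots> = settle prot R (deliver prot R (To_Coord i (first_reply r s i)) (?c\<lparr>pending := []\<rparr>))"
    by (rule settle_step) simp
  also have "deliver prot R (To_Coord i (first_reply r s i)) (?c\<lparr>pending := []\<rparr>) = ?d"
    by (simp add: coord_observe_def send_def Let_def rv act assms(1) comp_def level_len sum_list_triv)
  finally show ?thesis .
qed

lemma settle_level_broadcast:
  assumes "i \<le> k"
  shows "settle prot R \<lparr>server_view = (\<lambda>j. map Item (local_items j s) @
               (if j < k then [From_Coord (seed_code r)] else [])),
             coord_view = W, pending = map (\<lambda>j. To_Server j (level_code l)) [0..<k], bits = B\<rparr> =
         settle prot R \<lparr>server_view = (\<lambda>j. map Item (local_items j s) @
               (if j < k then [From_Coord (seed_code r)] else []) @
               (if j < i then [From_Coord (level_code l)] else [])),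
             coord_view = W, pending = map (\<lambda>j. To_Server j (level_code l)) [i..<k], bits = B\<rparr>"
    (is "?lhs = settle prot R (?c i)")
  using assms
proof (induction i)
  case 0
  then show ?case by simp
next
  case (Suc i)
  then have "[i..<k] = i # [Suc i..<k]" by (simp add: upt_conv_Cons)
  then have "settle prot R (?c i) = settle prot R (deliver prot R (To_Server i (level_code l))
      (?c i\<lparr>pending := map (\<lambda>j. To_Server j (level_code l)) [Suc i..<k]\<rparr>))"
    by (intro settle_step) simp
  also have "deliver prot R (To_Server i (level_code l))
      (?c i\<lparr>pending := map (\<lambda>j. To_Server j (level_code l)) [Suc i..<k]\<rparr>) = ?c (Suc i)"
    using Suc by (auto simp: server_observe_def send_def server_move_def Let_def fun_eq_iff)
  finally show ?case using Suc by simp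
qed

definition base_bits :: nat where
  "base_bits = k * (seed_bits + reply_bits + level_bits)"

lemma run_split:
  assumes "r < N" "fst R = r" "valid_stream n k s"
  shows "run_events prot R (arrivals s @ [Splitting]) init_config =
     Some \<lparr>server_view = (\<lambda>j. if j < k then split_view r s j else map Item (local_items j s)),
       coord_view = reply_view r s, pending = [], bits = base_bits\<rparr>"
proof -
  have nil: "run_events prot R [] = Some" by (rule ext) simp
  have "run_events prot R (arrivals s @ [Splitting]) init_config =
     Option.bind (settle prot R \<lparr>server_view = (\<lambda>j. map Item (local_items j s)), coord_view = [Split],
             pending = map (\<lambda>j. To_Server j (seed_code r)) [0..<k], bits = k * seed_bits\<rparr>) Some"
    using assms(2)
    by (simp add: run_events_append run_before_split coord_observe_def send_def coord_move_def
        Let_def comp_def sum_list_triv seed_len nil del: bind_runit)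
  also have "\<dots> = Option.bind (settle prot R \<lparr>server_view = (\<lambda>j. map Item (local_items j s) @
               (if j < k then [From_Coord (seed_code r)] else [])), coord_view = [Split],
             pending = map (\<lambda>j. To_Coord j (first_reply r s j)) [0..<k],
             bits = k * seed_bits + k * reply_bits\<rparr>) Some"
    by (subst settle_seed_broadcast[OF assms(1) order_refl]) simp
  also have "\<dots> = Option.bind (settle prot R \<lparr>server_view = (\<lambda>j. map Item (local_items j s) @
               (if j < k then [From_Coord (seed_code r)] else [])), coord_view = reply_view r s,
             pending = map (\<lambda>j. To_Server j (level_code (split_level r s))) [0..<k],
             bits = base_bits\<rparr>) Some"
    by (subst settle_all_replies[OF assms(2,3)]) (simp add: base_bits_def algebra_simps)
  also have "\<dots> = Some \<lparr>server_view = (\<lambda>j. if j < k then split_view r s j else map Item (local_items j s)),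
       coord_view = reply_view r s, pending = [], bits = base_bits\<rparr>"
    by (subst settle_level_broadcast[OF order_refl])
      (auto simp: settle_idle split_view_def fun_eq_iff)
  finally show ?thesis .
qed


section \<open>Execution after the splitting time\<close>

definition local_sample :: "nat \<Rightarrow> stream \<Rightarrow> stream \<Rightarrow> nat \<Rightarrow> nat set" where
  "local_sample r s s' j = set (local_items j (s @ s')) \<inter> sample r (split_level r s)"

text \<open>The bound on the bits charges the elements of the local samples, including those from
  before the splitting time, which were not sent one by one.\<close>

lemma run_after_split:
  assumes "r < N" "fst R = r" "valid_stream n k s" "valid_stream n k s'"
  shows "\<exists>V W B. run_events prot R (arrivals s @ Splitting # arrivals s') init_config =
      Some \<lparr>server_view = V, coord_view = reply_view r s @ W, pending = [], bits = B\<rparr> \<and>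
      (\<forall>j<k. V j = split_view r s j @ map Item (local_items j s')) \<and>
      B \<le> base_bits + item_bits * (\<Sum>j<k. min lim (card (local_sample r s s' j))) \<and>
      ((\<forall>j<k. card (local_sample r s s' j) \<le> lim) \<longrightarrow>
        received (reply_view r s @ W) \<union> (\<Union>j<k. local_sample r s [] j) = (\<Union>j<k. local_sample r s s' j))"
  using assms(4)
proof (induction s' rule: rev_induct)
  case Nil
  have "received (reply_view r s) = {}"
    by (simp add: received_def reply_view_def)
  then show ?case
    using run_split[OF assms(1-3)] by (auto simp: arrivals_def)
next
  case (snoc x s')
  obtain j i where x: "x = (j, i)" by (cases x)
  have ji: "j < k" "i < n" and vs': "valid_stream n k s'"
    using snoc.prems by (auto simp: valid_stream_def x)
  define S where "S = sample r (split_level r s)"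
  define T where "T = local_sample r s s'"
  define T' where "T' = local_sample r s (s' @ [x])"
  obtain V W B where run: "run_events prot R (arrivals s @ Splitting # arrivals s') init_config =
      Some \<lparr>server_view = V, coord_view = reply_view r s @ W, pending = [], bits = B\<rparr>"
    and V: "\<And>j. j < k \<Longrightarrow> V j = split_view r s j @ map Item (local_items j s')"
    and B: "B \<le> base_bits + item_bits * (\<Sum>j<k. min lim (card (T j)))"
    and rec: "(\<forall>j<k. card (T j) \<le> lim) \<Longrightarrow>
        received (reply_view r s @ W) \<union> (\<Union>j<k. local_sample r s [] j) = (\<Union>j<k. T j)"
    using snoc.IH[OF vs'] unfolding T_def by blast
  have T': "T' j = (if i \<in> S then insert i (T j) else T j)" "\<And>j'. j' \<noteq> j \<Longrightarrow> T' j' = T j'"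
    by (auto simp: T'_def T_def local_sample_def x local_items_append S_def local_items_def)
  have fin: "finite (T j)" for j by (simp add: T_def local_sample_def)
  \<comment> \<open>The server can compute its local sample from its own view, so its test for
    sending is exactly \<open>send_it\<close>.\<close>
  have Tj: "items (V j) \<inter> S = T j"
    using ji by (auto simp: V split_view_def T_def local_sample_def S_def local_items_append)
  have subT: "T j' \<subseteq> T' j'" for j' using T' by (cases "j' = j") auto
  have leT: "min lim (card (T j')) \<le> min lim (card (T' j'))" for j'
    using card_mono[OF _ subT] fin by (metis T'_def List.finite_set finite_Int local_sample_def min.mono order_refl)
  define send_it where "send_it \<longleftrightarrow> i \<in> S \<and> i \<notin> items (V j) \<and> card (T j) < lim"
  have inv: "inv_into {..<N} seed_code (seed_code r) = r"
    "inv_into {..Suc L} level_code (level_code (split_level r s)) = split_level r s"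
    using assms(1) level_le by (auto simp: split_level_def intro!: inv_into_f_f seed_inj level_inj)
  have "coord_msgs (V j @ [Item i]) = [seed_code r, level_code (split_level r s)]"
    using ji by (simp add: V split_view_def)
  then have act: "server_move j y (V j @ [Item i]) = (if send_it then Some (item_code i) else None)" for y
    unfolding server_move_def by (simp add: inv Let_def send_it_def flip: S_def Tj)
  have step: "run_events prot R (arrivals s @ Splitting # arrivals (s' @ [x])) init_config =
      settle prot R (server_observe prot R j (Item i)
        \<lparr>server_view = V, coord_view = reply_view r s @ W, pending = [], bits = B\<rparr>)"
  proof -
    have eq: "arrivals s @ Splitting # arrivals (s' @ [x]) =
        (arrivals s @ Splitting # arrivals s') @ [Arrival j i]"
      by (simp add: arrivals_def x)
    have nil: "run_events prot R [] = Some" by (rule ext) simp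
    show ?thesis
      unfolding eq run_events_append[of _ _ "arrivals s @ Splitting # arrivals s'"] run
      by (simp add: nil)
  qed
  have V': "(V(j := V j @ [Item i])) j' = split_view r s j' @ map Item (local_items j' (s' @ [x]))"
    if "j' < k" for j'
    using that by (auto simp: V x)
  have len: "length (reply_view r s) = Suc k" by (simp add: reply_view_def)
  show ?case
  proof (cases send_it)
    case False
    have "run_events prot R (arrivals s @ Splitting # arrivals (s' @ [x])) init_config =
      Some \<lparr>server_view = V(j := V j @ [Item i]), coord_view = reply_view r s @ W,
        pending = [], bits = B\<rparr>"
      unfolding step using False
      by (simp add: server_observe_def send_def Let_def act settle_idle)
    moreover have "B \<le> base_bits + item_bits * (\<Sum>j<k. min lim (card (T' j)))"
      using B by (rule order_trans) (intro add_left_mono mult_left_mono sum_mono leT, simp)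
    moreover have "received (reply_view r s @ W) \<union> (\<Union>j<k. local_sample r s [] j) = (\<Union>j<k. T' j)"
      if "\<forall>j<k. card (T' j) \<le> lim"
    proof -
      \<comment> \<open>A new sampled item is withheld only at the cutoff; the local sample would
        then exceed \<open>lim\<close>.\<close>
      have "T' j = T j"
      proof (rule ccontr)
        assume "T' j \<noteq> T j"
        then have "i \<in> S" "i \<notin> T j" using T'(1) by (auto split: if_splits)
        moreover from this have "i \<notin> items (V j)" using Tj by auto
        ultimately have "\<not> card (T j) < lim" "card (T' j) = Suc (card (T j))"
          using False fin by (auto simp: send_it_def T'(1))
        then show False using that ji by force
      qed
      then have eq: "T' = T" using T'(2) by (metis ext)
      show ?thesis using that unfolding eq by (rule rec)
    qed
    ultimately show ?thesis using V' unfolding T'_def by blast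
  next
    case True
    let ?W = "W @ [From_Server j (item_code i)]"
    let ?c = "\<lparr>server_view = V(j := V j @ [Item i]), coord_view = reply_view r s @ W,
        pending = [To_Coord j (item_code i)], bits = B + item_bits\<rparr>"
    have "run_events prot R (arrivals s @ Splitting # arrivals (s' @ [x])) init_config =
        settle prot R ?c"
      unfolding step using True
      by (simp add: server_observe_def send_def Let_def act item_len)
    also have "\<dots> = settle prot R (deliver prot R (To_Coord j (item_code i)) (?c\<lparr>pending := []\<rparr>))"
      by (rule settle_step) simp
    also have "\<dots> = Some \<lparr>server_view = V(j := V j @ [Item i]), coord_view = reply_view r s @ ?W,
        pending = [], bits = B + item_bits\<rparr>"
      by (simp add: coord_observe_def Let_def coord_move_def len send_def settle_idle)
    finally have 1: "run_events prot R (arrivals s @ Splitting # arrivals (s' @ [x])) init_config = \<dots>" .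
    have "i \<notin> T j" "card (T j) < lim" "i \<in> S" using True Tj by (auto simp: send_it_def)
    \<comment> \<open>The truncated size grows by exactly one, which pays for the forwarded
      item.\<close>
    then have "min lim (card (T' j)) = Suc (min lim (card (T j)))"
      using fin by (simp add: T'(1))
    then have "(\<Sum>j<k. min lim (card (T' j))) = Suc (\<Sum>j<k. min lim (card (T j)))"
      using ji T'(2) by (intro sum_Suc_at[of j]) auto
    then have 2: "B + item_bits \<le> base_bits + item_bits * (\<Sum>j<k. min lim (card (T' j)))"
      using B by (simp add: algebra_simps)
    have 3: "received (reply_view r s @ ?W) \<union> (\<Union>j<k. local_sample r s [] j) = (\<Union>j<k. T' j)"
      if "\<forall>j<k. card (T' j) \<le> lim"
    proof -
      have "received (reply_view r s @ ?W) = insert i (received (reply_view r s @ W))"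
        using ji inj_onD[OF item_inj] by (auto simp: received_def len)
      moreover have "(\<Union>j<k. T' j) = insert i (\<Union>j<k. T j)"
      proof -
        have "T' j' \<subseteq> insert i (T j')" for j' using T' by (cases "j' = j") auto
        moreover have "i \<in> T' j" using T'(1) \<open>i \<in> S\<close> by simp
        ultimately show ?thesis using ji(1) subT by blast
      qed
      moreover have "card (T j') \<le> lim" if "j' < k" for j'
        using \<open>\<forall>j<k. card (T' j) \<le> lim\<close> \<open>card (T j) < lim\<close> T'(2)[of j'] that by (cases "j' = j") auto
      ultimately show ?thesis using rec by auto
    qed
    show ?thesis using 1 2 3 V' unfolding T'_def by blast
  qed
qed

text \<open>The bound on the bits holds for every seed, as each server forwards at most
  \<open>lim\<close> items; only the value of the estimate needs the global sample to stay within
  the cutoff.\<close>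

lemma run_prot:
  fixes r t0 :: nat and s :: stream
  assumes "r < N" "fst R = r" "valid_stream n k s"
  defines "S \<equiv> sample r (level r (snd ` set (take t0 s)))"
  shows "\<exists>c. run prot R t0 s = Some c \<and>
      bits c \<le> k * (seed_bits + reply_bits + level_bits + lim * item_bits) \<and>
      (card (snd ` set s \<inter> S) \<le> lim \<longrightarrow>
        estimate r (coord_view c) = 2 ^ level r (snd ` set (take t0 s)) *
          real (card ((snd ` set s - snd ` set (take t0 s)) \<inter> S)))"
proof -
  let ?s = "take t0 s" and ?s' = "drop t0 s"
  have v: "valid_stream n k ?s" "valid_stream n k ?s'"
    using assms(3) set_take_subset[of t0 s] set_drop_subset[of t0 s]
    unfolding valid_stream_def by (blast intro: order_trans)+
  have un: "(\<Union>j<k. local_sample r ?s ?s' j) = snd ` set s \<inter> S"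
    "(\<Union>j<k. local_sample r ?s [] j) = snd ` set ?s \<inter> S"
    unfolding local_sample_def append_take_drop_id append_Nil2 UN_extend_simps(4)[symmetric]
      Union_local_items[OF assms(3)] Union_local_items[OF v(1)] split_level_def S_def
    by (rule refl)+
  have run_eq: "run_events prot R (arrivals ?s @ Splitting # arrivals ?s') init_config = run prot R t0 s"
    by (simp add: run_def arrivals_def)
  obtain V W B where *: "run prot R t0 s =
        Some \<lparr>server_view = V, coord_view = reply_view r ?s @ W, pending = [], bits = B\<rparr> \<and>
      (\<forall>j<k. V j = split_view r ?s j @ map Item (local_items j ?s')) \<and>
      B \<le> base_bits + item_bits * (\<Sum>j<k. min lim (card (local_sample r ?s ?s' j))) \<and>
      ((\<forall>j<k. card (local_sample r ?s ?s' j) \<le> lim) \<longrightarrow>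
        received (reply_view r ?s @ W) \<union> (\<Union>j<k. local_sample r ?s [] j) =
          (\<Union>j<k. local_sample r ?s ?s' j))"
    using run_after_split[OF assms(1,2) v] unfolding run_eq
    by (elim exE) (rule that)
  note c = *[THEN conjunct1] and B = *[THEN conjunct2, THEN conjunct2, THEN conjunct1]
    and rec = *[THEN conjunct2, THEN conjunct2, THEN conjunct2, THEN mp]
  have "(\<Sum>j<k. min lim (card (local_sample r ?s ?s' j))) \<le> (\<Sum>j<k. lim)"
    by (intro sum_mono) simp
  then have "item_bits * (\<Sum>j<k. min lim (card (local_sample r ?s ?s' j))) \<le> item_bits * (k * lim)"
    by (intro mult_le_mono2) simp
  then have "B \<le> base_bits + item_bits * (k * lim)"
    using B by linarith
  then have bits: "B \<le> k * (seed_bits + reply_bits + level_bits + lim * item_bits)"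
    by (simp add: base_bits_def algebra_simps)
  have est: "estimate r (reply_view r ?s @ W) = 2 ^ level r (snd ` set ?s) *
          real (card ((snd ` set s - snd ` set ?s) \<inter> S))"
    if le: "card (snd ` set s \<inter> S) \<le> lim"
  proof -
    have "card (local_sample r ?s ?s' j) \<le> lim" if "j < k" for j
    proof -
      have "local_sample r ?s ?s' j \<subseteq> snd ` set s \<inter> S" using that un(1) by blast
      then have "card (local_sample r ?s ?s' j) \<le> card (snd ` set s \<inter> S)" by (intro card_mono) auto
      then show ?thesis using le by simp
    qed
    then have "received (reply_view r ?s @ W) \<union> snd ` set ?s \<inter> S = snd ` set s \<inter> S"
      using rec unfolding un by blast
    then have "received (reply_view r ?s @ W) - snd ` set ?s \<inter> S = (snd ` set s - snd ` set ?s) \<inter> S"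
      by blast
    then show ?thesis
      unfolding estimate_def coord_level_reply_view[OF v(1)]
      by (simp add: S_def split_level_def)
  qed
  show ?thesis using bits est by (simp add: c)
qed

end

section \<open>Codes of fixed length\<close>

lemma ex_binary_code:
  assumes "finite X" "card X \<le> 2 ^ m"
  shows "\<exists>e :: 'a \<Rightarrow> bool list. inj_on e X \<and> (\<forall>x. length (e x) = m)"
proof -
  let ?B = "{bs :: bool list. length bs = m}"
  have B: "finite ?B" "card ?B = 2 ^ m"
    using finite_lists_length_eq[of "UNIV :: bool set" m] card_lists_length_eq[of "UNIV :: bool set" m]
    by simp_all
  from card_le_inj[OF assms(1) B(1)] obtain e where e: "inj_on e X" "e ` X \<subseteq> ?B"
    unfolding B(2) using assms(2) by blast
  \<comment> \<open>A default word outside \<open>X\<close> makes the length constant for all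
    arguments, as the locale demands.\<close>
  define e' where "e' x = (if x \<in> X then e x else replicate m True)" for x
  have "inj_on e' X" using e(1) by (simp add: e'_def inj_on_def)
  moreover have "length (e' x) = m" for x using e(2) by (auto simp: e'_def)
  ultimately show ?thesis by blast
qed

text \<open>Each set is listed and padded to length exactly \<open>c\<close> with the letter
  \<open>n\<close>, which is not an item.\<close>

lemma card_bounded_subsets_le:
  "finite {A. A \<subseteq> {..<n} \<and> card A \<le> c}" "card {A. A \<subseteq> {..<n} \<and> card A \<le> c} \<le> Suc n ^ c"
proof -
  show "finite {A. A \<subseteq> {..<n} \<and> card A \<le> c}" by (rule finite_subset[of _ "Pow {..<n}"]) auto
  let ?X = "{xs. set xs \<subseteq> {..n} \<and> length xs = c}"
  have X: "finite ?X" "card ?X = Suc n ^ c"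
    by (simp_all add: finite_lists_length_eq card_lists_length_eq)
  have "{A. A \<subseteq> {..<n} \<and> card A \<le> c} \<subseteq> (\<lambda>xs. set xs \<inter> {..<n}) ` ?X"
  proof
    fix A assume "A \<in> {A. A \<subseteq> {..<n} \<and> card A \<le> c}"
    then have A: "A \<subseteq> {..<n}" "card A \<le> c" "finite A" by (auto intro: finite_subset)
    let ?xs = "sorted_list_of_set A @ replicate (c - card A) n"
    have "?xs \<in> ?X" using A by (auto simp: set_replicate_conv_if)
    moreover have "A = set ?xs \<inter> {..<n}" using A by (simp add: set_replicate_conv_if) blast
    ultimately show "A \<in> (\<lambda>xs. set xs \<inter> {..<n}) ` ?X" by blast
  qed
  then have "card {A. A \<subseteq> {..<n} \<and> card A \<le> c} \<le> card ((\<lambda>xs. set xs \<inter> {..<n}) ` ?X)"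
    by (intro card_mono finite_imageI X(1))
  also have "\<dots> \<le> Suc n ^ c" using card_image_le[OF X(1)] unfolding X(2) .
  finally show "card {A. A \<subseteq> {..<n} \<and> card A \<le> c} \<le> Suc n ^ c" .
qed

section \<open>Accuracy and communication\<close>

text \<open>As \<open>N \<ge> n ^ (a + 8)\<close>, a failure probability of \<open>4 / N\<close> is
  at most \<open>q / 4\<close> for \<open>q = 1 / n ^ (a + 4)\<close>, and
  \<open>q * N / 2 \<ge> 4 * n\<close>, while there are fewer than \<open>2 ^ (4 * n)\<close>
  triples of two sets and a level. The surplus factor \<open>n ^ 4\<close> in \<open>q\<close> is
  reserved for the union bound over times and levels.\<close>

lemma ex_hash_family:
  fixes n L a cap :: nat
  assumes n: "2 \<le> n" "n \<le> 2 ^ L" "L \<le> n" and e: "0 < \<epsilon>" "\<epsilon> < 1" "\<epsilon> < \<gamma>"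
    and cap: "64 * real ((a + 8) * L) * (\<gamma> / \<epsilon>\<^sup>2) \<le> real cap"
  defines "N \<equiv> 2 ^ ((a + 8) * L)"
  shows "\<exists>g. (\<forall>r i. g r i \<le> L) \<and> (\<forall>U W l. U \<subseteq> {..<n} \<and> W \<subseteq> {..<n} \<and> l \<le> L \<longrightarrow>
      real (card {r. r < N \<and> bad_hash cap \<gamma> \<epsilon> U W l (g r)}) \<le> 1 / real n ^ (a + 4) * real N)"
proof -
  define q where "q = 1 / real n ^ (a + 4)"
  have npos: "0 < real n" using n by simp
  have n4: "real n ^ (a + 4) * real n ^ 4 \<le> real N"
  proof -
    have "real n ^ (a + 4) * real n ^ 4 = real (n ^ (a + 8))" by (simp add: add.commute flip: power_add)
    also have "n ^ (a + 8) \<le> (2 ^ L) ^ (a + 8)" using n by (intro power_mono) auto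
    then have "real (n ^ (a + 8)) \<le> real N"
      unfolding N_def by (metis of_nat_le_iff power_mult mult.commute)
    finally show ?thesis .
  qed
  have "(2::real) ^ 4 \<le> real n ^ 4" using n by (intro power_mono) auto
  then have "real n ^ (a + 4) * 16 \<le> real n ^ (a + 4) * real n ^ 4" by (intro mult_left_mono) auto
  then have N16: "16 * real n ^ (a + 4) \<le> real N" using n4 by simp
  have qN: "4 * real n \<le> q * real N / 2"
  proof -
    have "(2::real) ^ 3 \<le> real n ^ 3" using n by (intro power_mono) auto
    then have "real n * 8 \<le> real n * real n ^ 3" by (intro mult_left_mono) auto
    then have "8 * real n \<le> real n ^ 4" by (simp add: numeral_eq_Suc)
    also have "\<dots> \<le> q * real N" using n4 npos by (simp add: q_def le_divide_eq mult.commute)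
    finally show ?thesis by simp
  qed
  let ?E = "Pow {..<n} \<times> Pow {..<n} \<times> {..L}"
  have E: "real (card ?E) < 2 powr (q * real N / 2)"
  proof -
    have "card ?E = 2 ^ n * (2 ^ n * Suc L)" by (simp add: card_cartesian_product card_Pow)
    also have "\<dots> \<le> 2 ^ n * (2 ^ n * 2 ^ n)"
      using n(3) less_exp[of n] by (intro mult_le_mono2) linarith
    also have "\<dots> = 2 ^ (3 * n)" by (simp flip: power_add)
    also have "\<dots> < 2 ^ (4 * n)" using n by (intro power_strict_increasing) auto
    finally have "real (card ?E) < real (2 ^ (4 * n))" by (simp only: of_nat_less_iff)
    also have "\<dots> = 2 powr real (4 * n)" by (subst powr_realpow) simp_all
    also have "\<dots> \<le> 2 powr (q * real N / 2)" using qN by (intro powr_mono) auto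
    finally show ?thesis .
  qed
  have prob: "measure_pmf.prob (hash_pmf n) {h. bad_hash cap \<gamma> \<epsilon> U W l h} \<le> q / 4"
    if "U \<subseteq> {..<n}" "W \<subseteq> {..<n}" for U W l
  proof -
    have "measure_pmf.prob (hash_pmf n) {h. bad_hash cap \<gamma> \<epsilon> U W l h} \<le> 4 * exp (- real ((a + 8) * L))"
      using that e cap by (intro prob_bad_hash) auto
    also have "exp (- real ((a + 8) * L)) \<le> 1 / real N"
    proof -
      have "(2::real) \<le> exp 1" using exp_ge_add_one_self[of 1] by simp
      then have "real N \<le> exp 1 ^ ((a + 8) * L)" unfolding N_def of_nat_power by (intro power_mono) auto
      also have "\<dots> = exp (real ((a + 8) * L))" by (simp flip: exp_of_nat_mult)
      finally have "1 / exp (real ((a + 8) * L)) \<le> 1 / real N"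
        by (intro divide_left_mono) (auto simp: N_def)
      then show ?thesis by (simp only: exp_minus inverse_eq_divide)
    qed
    also have "4 * (1 / real N) \<le> q / 4"
      using N16 npos by (simp add: q_def N_def field_simps)
    finally show ?thesis by simp
  qed
  have "\<exists>h. \<forall>x\<in>?E. real (card {r. r < N \<and>
      (case x of (U, W, l) \<Rightarrow> bad_hash cap \<gamma> \<epsilon> U W l) (h r)}) \<le> q * real N"
    using prob E npos by (intro ex_small_family[where M = "hash_pmf n"]) (auto simp: q_def)
  then obtain h where h: "\<forall>x\<in>?E. real (card {r. r < N \<and>
      (case x of (U, W, l) \<Rightarrow> bad_hash cap \<gamma> \<epsilon> U W l) (h r)}) \<le> q * real N" ..
  \<comment> \<open>Truncating hash values at \<open>L\<close> leaves the samples at levels up to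
    \<open>L\<close> unchanged.\<close>
  define g where "g r i = min L (h r i)" for r i
  have "bad_hash cap \<gamma> \<epsilon> U W l (g r) = bad_hash cap \<gamma> \<epsilon> U W l (h r)" if "l \<le> L" for U W l r
    using that by (simp add: bad_hash_def g_def)
  then have "real (card {r. r < N \<and> bad_hash cap \<gamma> \<epsilon> U W l (g r)}) \<le> 1 / real n ^ (a + 4) * real N"
    if "U \<subseteq> {..<n}" "W \<subseteq> {..<n}" "l \<le> L" for U W l
    using h[rule_format, of "(U, W, l)"] that by (simp add: q_def)
  then show ?thesis by (intro exI[of _ g]) (auto simp: g_def)
qed

section \<open>Distinct items of a stream, and the silent protocol\<close>

lemma support_freq:
  assumes "valid_stream n k s"
  shows "{i. i < n \<and> freq s i \<noteq> 0} = snd ` set s"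
proof -
  have "snd ` set s \<subseteq> {..<n}" using assms by (auto simp: valid_stream_def)
  moreover have "freq s i \<noteq> 0 \<longleftrightarrow> i \<in> snd ` set s" for i
    by (induction s) (auto simp: freq_def)
  ultimately show ?thesis by blast
qed

lemma valid_stream_take: "valid_stream n k s \<Longrightarrow> valid_stream n k (take t s)"
  unfolding valid_stream_def using set_take_subset by (rule order_trans)

lemma F0_pre_vec:
  assumes "valid_stream n k s"
  shows "F0 n (pre_vec t0 s) = real (card (snd ` set (take t0 s)))"
  using support_freq[OF valid_stream_take[OF assms]] by (simp add: F0_def pre_vec_def)

lemma difference_F0:
  assumes "valid_stream n k s" "t0 \<le> t"
  shows "difference (F0 n) (pre_vec t0 s) (post_vec t0 t s) =
    real (card (snd ` set (take t s) - snd ` set (take t0 s)))"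
proof -
  have t: "take t s = take t0 s @ drop t0 (take t s)"
    using append_take_drop_id[of t0 "take t s"] assms(2) by (simp add: min_absorb2)
  have "pre_vec t0 s i + post_vec t0 t s i = freq (take t s) i" for i
    by (subst t) (simp add: pre_vec_def post_vec_def freq_def)
  then have "F0 n (\<lambda>i. pre_vec t0 s i + post_vec t0 t s i) = real (card (snd ` set (take t s)))"
    using support_freq[OF valid_stream_take[OF assms(1)]] by (simp add: F0_def)
  moreover have "snd ` set (take t0 s) \<subseteq> snd ` set (take t s)"
    by (intro image_mono set_take_subset_set_take assms(2))
  ultimately show ?thesis
    unfolding difference_def F0_pre_vec[OF assms(1)]
    by (simp add: card_Diff_subset of_nat_diff card_mono)
qed

definition silent :: protocol where
  "silent = \<lparr>server_coins = (\<lambda>_. return_pmf 0), coord_coins = return_pmf 0,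
     server_act = (\<lambda>_ _ _. None), coord_act = (\<lambda>_ _. []), coord_out = (\<lambda>_ _. 0)\<rparr>"

lemma wf_silent: "wf_protocol k silent"
  by (simp add: wf_protocol_def silent_def)

lemma run_silent: "\<exists>c. run silent R t0 s = Some c \<and> bits c = 0"
proof -
  have "\<exists>c'. run_events silent R es c = Some c' \<and> bits c' = bits c" if "pending c = []" for es c
    using that
  proof (induction es arbitrary: c)
    case (Cons e es)
    have "pending (inject silent R e c) = []" "bits (inject silent R e c) = bits c"
      using Cons.prems
      by (cases e; simp add: silent_def server_observe_def coord_observe_def send_def Let_def)+
    then show ?case using Cons.IH[of "inject silent R e c"] by (simp add: settle_idle)
  qed simp
  from this[of init_config] show ?thesis unfolding run_def by (simp add: init_config_def)
qed

lemma communication_silent: "0 \<le> B \<Longrightarrow> communication_at_most n k F \<gamma> silent B"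
  unfolding communication_at_most_def using run_silent by (metis of_nat_0)

text \<open>For \<open>1 \<le> \<delta>\<close> nothing is required. Otherwise the difference is
  nonnegative, and the promise bounds it by the allowed error.\<close>

lemma estimator_silent:
  assumes "1 \<le> \<delta> \<or> 0 \<le> \<delta> \<and> \<gamma> \<le> \<epsilon>"
  shows "continuous_difference_estimator n k (F0 n) \<gamma> \<epsilon> \<delta> silent"
  unfolding continuous_difference_estimator_def
proof (intro conjI allI impI wf_silent)
  fix t0 s assume prom: "promise_input n k (F0 n) \<gamma> t0 s"
  let ?G = "{R. \<forall>t \<in> {t0..length s}. \<exists>c. run silent R t0 (take t s) = Some c \<and>
                \<bar>coord_out silent (fst R) (coord_view c)
                   - difference (F0 n) (pre_vec t0 s) (post_vec t0 t s)\<bar> \<le> \<epsilon> * F0 n (pre_vec t0 s)}"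
  show "1 - \<delta> \<le> measure_pmf.prob (coins_pmf k silent) ?G"
  proof (cases "1 \<le> \<delta>")
    case True
    then have "1 - \<delta> \<le> 0" by simp
    also have "0 \<le> measure_pmf.prob (coins_pmf k silent) ?G" by simp
    finally show ?thesis .
  next
    case False
    then have d: "0 \<le> \<delta>" "\<gamma> \<le> \<epsilon>" using assms by auto
    have "R \<in> ?G" for R
    proof (simp only: mem_Collect_eq, intro ballI)
      fix t assume t: "t \<in> {t0..length s}"
      have v: "valid_stream n k s" using prom by (simp add: promise_input_def)
      let ?D = "difference (F0 n) (pre_vec t0 s) (post_vec t0 t s)"
      have "?D \<le> \<gamma> * F0 n (pre_vec t0 s)" using prom t by (simp add: promise_input_def)
      also have "\<dots> \<le> \<epsilon> * F0 n (pre_vec t0 s)" using d by (intro mult_right_mono) (auto simp: F0_def)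
      finally have "\<bar>0 - ?D\<bar> \<le> \<epsilon> * F0 n (pre_vec t0 s)"
        using difference_F0[OF v, of t0 t] t by simp
      moreover have "coord_out silent r h = 0" for r h by (simp add: silent_def)
      ultimately show "\<exists>c. run silent R t0 (take t s) = Some c \<and>
          \<bar>coord_out silent (fst R) (coord_view c) - ?D\<bar> \<le> \<epsilon> * F0 n (pre_vec t0 s)"
        using run_silent[of R t0 "take t s"] by auto
    qed
    then have "?G = UNIV" by blast
    then show ?thesis using d by simp
  qed
qed

text \<open>Members of a chain of finite sets are distinguished by their cardinalities.\<close>

lemma card_chain_le:
  assumes "\<And>A. A \<in> C \<Longrightarrow> A \<subseteq> {..<n::nat}" "\<And>A B. A \<in> C \<Longrightarrow> B \<in> C \<Longrightarrow> A \<subseteq> B \<or> B \<subseteq> A"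
  shows "card C \<le> Suc n"
proof -
  have fin: "finite A" if "A \<in> C" for A using assms(1)[OF that] finite_subset by auto
  have "inj_on card C"
  proof (rule inj_onI)
    fix A B assume "A \<in> C" "B \<in> C" "card A = card B"
    then show "A = B" using assms(2)[of A B] fin card_subset_eq by metis
  qed
  moreover have "card ` C \<subseteq> {..n}"
  proof
    fix x assume "x \<in> card ` C"
    then obtain A where "A \<in> C" "x = card A" by blast
    then show "x \<in> {..n}" using card_mono[OF finite_lessThan assms(1)] by fastforce
  qed
  ultimately show ?thesis using card_inj_on_le[of card C "{..n}"] by simp
qed

section \<open>Worst-case communication and the union bound over times and levels\<close>

context sampling_protocol
begin

lemma communication_prot:
  assumes "0 < N"
  shows "communication_at_most n k (F0 n) \<gamma> prot
    (real (k * (seed_bits + reply_bits + level_bits + lim * item_bits)))"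
  unfolding communication_at_most_def
proof (intro allI impI ballI)
  fix t0 s R assume "promise_input n k (F0 n) \<gamma> t0 s" "R \<in> set_pmf (coins_pmf k prot)"
  then have v: "valid_stream n k s" and "fst R < N"
    using assms by (auto simp: promise_input_def coins_pmf_def set_pmf_of_set lessThan_empty_iff)
  from run_prot[OF this(2) refl v, of t0]
  show "\<exists>c. run prot R t0 s = Some c \<and>
      real (bits c) \<le> real (k * (seed_bits + reply_bits + level_bits + lim * item_bits))"
    unfolding of_nat_le_iff by blast
qed

text \<open>The input is fixed, so \<open>U\<close> is fixed, and a seed fails only if its hash is
  bad for one of at most \<open>Suc n * Suc L\<close> pairs of a set of new items and a level. Any
  other seed is accurate at all times at once.\<close>

lemma estimator_prot:
  assumes N: "0 < N" and L: "n \<le> 2 ^ L" and cap: "2 \<le> cap" and e: "0 < \<epsilon>" "\<epsilon> < \<gamma>"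
    and lim: "real cap + 4 * \<gamma> * real cap \<le> real lim"
    and family: "\<And>U W l. U \<subseteq> {..<n} \<Longrightarrow> W \<subseteq> {..<n} \<Longrightarrow> l \<le> L \<Longrightarrow>
      real (card {r. r < N \<and> bad_hash cap \<gamma> \<epsilon> U W l (g r)}) \<le> q * real N"
    and q: "0 \<le> q" "real (Suc n * Suc L) * q \<le> \<delta>"
  shows "continuous_difference_estimator n k (F0 n) \<gamma> \<epsilon> \<delta> prot"
  unfolding continuous_difference_estimator_def
proof (intro conjI allI impI wf_prot)
  fix t0 s assume prom: "promise_input n k (F0 n) \<gamma> t0 s"
  then have v: "valid_stream n k s" by (simp add: promise_input_def)
  let ?G = "{R. \<forall>t \<in> {t0..length s}. \<exists>c. run prot R t0 (take t s) = Some c \<and>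
                \<bar>coord_out prot (fst R) (coord_view c)
                   - difference (F0 n) (pre_vec t0 s) (post_vec t0 t s)\<bar> \<le> \<epsilon> * F0 n (pre_vec t0 s)}"
  define U where "U = snd ` set (take t0 s)"
  define W where "W t = snd ` set (take t s) - U" for t
  have sub: "snd ` set (take t s) \<subseteq> {..<n}" for t
    using valid_stream_take[OF v, of t] by (auto simp: valid_stream_def)
  have Un: "U \<subseteq> {..<n}" and Wn: "\<And>t. W t \<subseteq> {..<n}" using sub by (auto simp: U_def W_def)
  \<comment> \<open>Counting distinct sets instead of times makes the union bound independent of the
    length of the stream.\<close>
  define C where "C = W ` {t0..length s}"
  have "card C \<le> Suc n"
  proof (rule card_chain_le)
    fix A B assume "A \<in> C" "B \<in> C"
    then obtain t t' where "A = W t" "B = W t'" by (auto simp: C_def)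
    moreover have "W t \<subseteq> W t'" if "t \<le> t'" for t t'
      using set_take_subset_set_take[OF that, of s] by (auto simp: W_def)
    ultimately show "A \<subseteq> B \<or> B \<subseteq> A" using nat_le_linear[of t t'] by blast
  qed (use Wn in \<open>auto simp: C_def\<close>)
  define bad where "bad = (\<Union>(A, l)\<in>C \<times> {..L}. {r. r < N \<and> bad_hash cap \<gamma> \<epsilon> U A l (g r)})"
  have "real (card bad) \<le> \<delta> * real N"
  proof -
    have "card bad \<le> (\<Sum>(A, l)\<in>C \<times> {..L}. card {r. r < N \<and> bad_hash cap \<gamma> \<epsilon> U A l (g r)})"
      unfolding bad_def by (rule order_trans[OF card_UN_le]) (auto simp: C_def case_prod_unfold)
    then have "real (card bad) \<le> real (\<Sum>(A, l)\<in>C \<times> {..L}. card {r. r < N \<and> bad_hash cap \<gamma> \<epsilon> U A l (g r)})"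
      by (simp only: of_nat_le_iff)
    also have "\<dots> \<le> (\<Sum>x\<in>C \<times> {..L}. q * real N)"
      unfolding of_nat_sum
      by (intro sum_mono) (use Un Wn in \<open>auto simp: C_def intro!: family\<close>)
    also have "\<dots> = real (card C * Suc L) * (q * real N)" by (simp add: card_cartesian_product)
    also have "\<dots> \<le> real (Suc n * Suc L) * (q * real N)"
      using \<open>card C \<le> Suc n\<close> q by (intro mult_right_mono of_nat_mono mult_le_mono1) auto
    also have "\<dots> \<le> \<delta> * real N" using mult_right_mono[OF q(2), of "real N"] by (simp only: mult.assoc)
    finally show ?thesis .
  qed
  have good: "R \<in> ?G" if R: "fst R \<in> {..<N} - bad" for R
  proof (simp only: mem_Collect_eq, intro ballI)
    fix t assume t: "t \<in> {t0..length s}"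
    define r where "r = fst R"
    have r: "r < N" using R by (simp add: r_def)
    define S where "S = sample r (level r U)"
    obtain c where c: "run prot R t0 (take t s) = Some c"
      and est: "card (snd ` set (take t s) \<inter> S) \<le> lim \<Longrightarrow>
        estimate r (coord_view c) = 2 ^ level r U * real (card (W t \<inter> S))"
    proof -
      have "take t0 (take t s) = take t0 s" using t by (simp add: min_def)
      note * = run_prot[OF r r_def[symmetric] valid_stream_take[OF v, of t], of t0,
          unfolded this, folded U_def, folded S_def, folded W_def]
      show thesis using * by (elim exE conjE) (rule that, assumption, erule mp)
    qed
    have D: "difference (F0 n) (pre_vec t0 s) (post_vec t0 t s) = real (card (W t))"
      using difference_F0[OF v, of t0 t] t by (simp add: W_def U_def)
    have F: "F0 n (pre_vec t0 s) = real (card U)" using F0_pre_vec[OF v] by (simp add: U_def)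
    have W: "real (card (W t)) \<le> \<gamma> * real (card U)"
    proof -
      have "difference (F0 n) (pre_vec t0 s) (post_vec t0 t s) \<le> \<gamma> * F0 n (pre_vec t0 s)"
        using prom t by (simp add: promise_input_def)
      then show ?thesis unfolding D F .
    qed
    have notbad: "\<not> bad_hash cap \<gamma> \<epsilon> U (W t) l (g r)" if "l \<le> L" for l
    proof
      assume "bad_hash cap \<gamma> \<epsilon> U (W t) l (g r)"
      then have "r \<in> bad" unfolding bad_def
        using that r t by (intro UN_I[of "(W t, l)"]) (simp_all add: C_def)
      then show False using R by (simp add: r_def)
    qed
    have lv: "(LEAST l. card (U \<inter> {i. l \<le> g r i}) \<le> cap) = level r U"
      by (simp add: level_def sample_def)
    have acc1: "\<bar>2 ^ level r U * real (card (W t \<inter> S)) - real (card (W t))\<bar> \<le> \<epsilon> * real (card U)"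
      and acc2: "real (card (W t \<inter> S)) \<le> 4 * \<gamma> * real cap"
      using good_hash_level[OF Un Wn e W L cap notbad]
      unfolding lv S_def sample_def by auto
    \<comment> \<open>Old and new sampled items together number at most
      \<open>cap + 4 * \<gamma> * cap\<close>, so no server is stopped by the cutoff.\<close>
    have "snd ` set (take t s) \<inter> S \<subseteq> (U \<inter> S) \<union> (W t \<inter> S)" by (auto simp: W_def)
    then have "card (snd ` set (take t s) \<inter> S) \<le> card ((U \<inter> S) \<union> (W t \<inter> S))"
      by (intro card_mono) (auto simp: U_def W_def)
    also have "\<dots> \<le> card (U \<inter> S) + card (W t \<inter> S)" by (rule card_Un_le)
    also have "\<dots> \<le> cap + card (W t \<inter> S)" using card_level[of U r] by (simp add: S_def)
    finally have "real (card (snd ` set (take t s) \<inter> S)) \<le> real cap + real (card (W t \<inter> S))" by linarith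
    then have "card (snd ` set (take t s) \<inter> S) \<le> lim" using acc2 lim by linarith
    then show "\<exists>c. run prot R t0 (take t s) = Some c \<and>
        \<bar>coord_out prot (fst R) (coord_view c) - difference (F0 n) (pre_vec t0 s) (post_vec t0 t s)\<bar>
          \<le> \<epsilon> * F0 n (pre_vec t0 s)"
      using c est acc1 unfolding D F prot_simps r_def[symmetric] by (intro exI[of _ c]) simp
  qed
  have "bad \<subseteq> {..<N}" by (auto simp: bad_def)
  then have "real (card ({..<N} - bad)) = real N - real (card bad)"
    using card_mono[OF finite_lessThan \<open>bad \<subseteq> {..<N}\<close>]
    by (simp add: card_Diff_subset finite_subset of_nat_diff)
  then have "(1 - \<delta>) * real N \<le> real (card ({..<N} - bad))"
    using \<open>real (card bad) \<le> \<delta> * real N\<close> by (simp add: algebra_simps)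
  then have "1 - \<delta> \<le> real (card ({..<N} - bad)) / real N"
    using N by (simp add: le_divide_eq)
  also have "\<dots> = measure_pmf.prob (pmf_of_set {..<N}) ({..<N} - bad)"
  proof -
    have "{..<N} \<inter> ({..<N} - bad) = {..<N} - bad" by blast
    then show ?thesis using N by (subst measure_pmf_of_set) (auto simp: lessThan_empty_iff)
  qed
  \<comment> \<open>Goodness depends only on the seed, the first component of the coins.\<close>
  also have "\<dots> = measure_pmf.prob (map_pmf fst (coins_pmf k prot)) ({..<N} - bad)"
    by (simp add: coins_pmf_def map_fst_pair_pmf)
  also have "\<dots> = measure_pmf.prob (coins_pmf k prot) (fst -` ({..<N} - bad))" by simp
  also have "\<dots> \<le> measure_pmf.prob (coins_pmf k prot) ?G"
    by (intro measure_pmf.finite_measure_mono) (use good in auto)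
  finally show "1 - \<delta> \<le> measure_pmf.prob (coins_pmf k prot) ?G" .
qed

end

section \<open>Choice of the codes\<close>

lemma ex_sampling_protocol:
  fixes n k L a cap lim :: nat
  assumes n: "2 \<le> n" "n \<le> 2 ^ L" "L \<le> n" and k: "1 \<le> k"
    and e: "0 < \<epsilon>" "\<epsilon> < 1" "\<epsilon> < \<gamma>" and cap2: "2 \<le> cap"
    and cap: "64 * real ((a + 8) * L) * (\<gamma> / \<epsilon>\<^sup>2) \<le> real cap"
    and lim: "real cap + 4 * \<gamma> * real cap \<le> real lim"
  shows "\<exists>P. continuous_difference_estimator n k (F0 n) \<gamma> \<epsilon> (1 / real n ^ a) P \<and>
    communication_at_most n k (F0 n) \<gamma> P
      (real (k * ((a + 8) * L + Suc L * Suc cap + Suc (Suc L) + lim * L)))"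
proof -
  define N :: nat where "N = 2 ^ ((a + 8) * L)"
  have L: "0 < L" using n by (cases L) auto
  obtain g where g: "\<And>r i. g r i \<le> L" and family: "\<And>U W l. U \<subseteq> {..<n} \<and> W \<subseteq> {..<n} \<and> l \<le> L \<Longrightarrow>
      real (card {r. r < N \<and> bad_hash cap \<gamma> \<epsilon> U W l (g r)}) \<le> 1 / real n ^ (a + 4) * real N"
    using ex_hash_family[OF n e cap] unfolding N_def by blast
  obtain seed_code :: "nat \<Rightarrow> msg"
    where seed: "inj_on seed_code {..<N}" "\<And>r. length (seed_code r) = (a + 8) * L"
    using ex_binary_code[of "{..<N}" "(a + 8) * L"] by (auto simp: N_def)
  have SL: "Suc (Suc L) \<le> 2 ^ Suc L" using less_exp[of "Suc L"] by linarith
  then have "Suc (Suc L) \<le> 2 ^ Suc (Suc L)" by simp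
  then obtain level_code :: "nat \<Rightarrow> msg"
    where level: "inj_on level_code {..Suc L}" "\<And>l. length (level_code l) = Suc (Suc L)"
    using ex_binary_code[of "{..Suc L}" "Suc (Suc L)"] by auto
  obtain item_code :: "nat \<Rightarrow> msg"
    where item: "inj_on item_code {..<n}" "\<And>i. length (item_code i) = L"
    using ex_binary_code[of "{..<n}" L] n by auto
  let ?Q = "{..Suc L} \<times> {A. A \<subseteq> {..<n} \<and> card A \<le> cap}"
  have "card ?Q \<le> Suc (Suc L) * Suc n ^ cap"
    unfolding card_cartesian_product card_atMost by (intro mult_le_mono2 card_bounded_subsets_le(2))
  \<comment> \<open>The level and each of the \<open>cap\<close> letters, including the padding
    letter, take \<open>Suc L\<close> bits.\<close>
  also have "\<dots> \<le> 2 ^ Suc L * (2 ^ Suc L) ^ cap"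
  proof (intro mult_le_mono SL power_mono)
    have "1 \<le> (2::nat) ^ L" by simp
    then show "Suc n \<le> 2 ^ Suc L" using n(2) unfolding power_Suc by linarith
  qed simp
  also have "\<dots> = 2 ^ (Suc L * Suc cap)"
    unfolding power_mult power_Suc ..
  finally have "card ?Q \<le> 2 ^ (Suc L * Suc cap)" .
  moreover have "finite ?Q" by (intro finite_cartesian_product finite_atMost card_bounded_subsets_le(1))
  ultimately obtain reply_code :: "nat \<times> nat set \<Rightarrow> msg"
    where reply: "inj_on reply_code ?Q" "\<And>x. length (reply_code x) = Suc L * Suc cap"
    using ex_binary_code[of ?Q "Suc L * Suc cap"] by blast
  interpret sampling_protocol n k L cap lim N g seed_code level_code item_code reply_code
    "(a + 8) * L" "Suc (Suc L)" L "Suc L * Suc cap"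
    using k g seed level item reply L by unfold_locales auto
  have npos: "0 < real n" using n by simp
  \<comment> \<open>This consumes the factor \<open>n ^ 4\<close> reserved in the quality of the
    hash family.\<close>
  have "real (Suc n * Suc L) \<le> real n ^ 4"
  proof -
    have "Suc n * Suc L \<le> (2 * n) * (2 * n)" using n by (intro mult_le_mono) auto
    also have "\<dots> = 4 * (n * n)" by simp
    also have "\<dots> \<le> (n * n) * (n * n)" using n mult_le_mono[of 2 n 2 n] by (intro mult_le_mono1) simp
    also have "\<dots> = n ^ 4" by (simp add: numeral_eq_Suc)
    finally show ?thesis by (metis of_nat_le_iff of_nat_power)
  qed
  then have "real (Suc n * Suc L) * (1 / real n ^ (a + 4)) \<le> real n ^ 4 * (1 / real n ^ (a + 4))"
    by (intro mult_right_mono) auto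
  also have "\<dots> = 1 / real n ^ a" using npos by (simp add: power_add)
  finally have q: "real (Suc n * Suc L) * (1 / real n ^ (a + 4)) \<le> 1 / real n ^ a" .
  have N: "0 < N" by (simp add: N_def)
  have "continuous_difference_estimator n k (F0 n) \<gamma> \<epsilon> (1 / real n ^ a) prot"
    by (rule estimator_prot[OF N n(2) cap2 e(1,3) lim family _ q]) simp_all
  moreover have "communication_at_most n k (F0 n) \<gamma> prot
      (real (k * ((a + 8) * L + Suc L * Suc cap + Suc (Suc L) + lim * L)))"
    by (rule communication_prot[OF N])
  ultimately show ?thesis by blast
qed

lemma communication_at_most_mono:
  "communication_at_most n k F \<gamma> P B \<Longrightarrow> B \<le> B' \<Longrightarrow> communication_at_most n k F \<gamma> P B'"
  unfolding communication_at_most_def by (meson order_trans)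

text \<open>Each summand is at most a multiple of \<open>L * cap\<close>, with factors
  \<open>a + 8\<close>, 4, 3 and \<open>G\<close>. Inserting the bound on \<open>cap\<close> gives a
  second factor \<open>L\<close>, and \<open>L \<le> 2 * l\<close> turns 128 into 512.\<close>

lemma total_bits_le:
  fixes L a cap G k :: nat and x l :: real
  assumes "1 \<le> L" "1 \<le> cap" and L: "real L \<le> 2 * l" and x: "0 \<le> x"
    and cap: "real cap \<le> 128 * real ((a + 8) * L) * x"
  shows "real (k * ((a + 8) * L + Suc L * Suc cap + Suc (Suc L) + (G * cap) * L))
    \<le> 512 * real (a + 8) * real (a + 15 + G) * (real k * x * l\<^sup>2)"
proof -
  have "(a + 8) * L + Suc L * Suc cap + Suc (Suc L) + (G * cap) * L \<le> (a + 15 + G) * (L * cap)"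
  proof -
    have "Suc L * Suc cap \<le> (2 * L) * (2 * cap)" using assms by (intro mult_le_mono) auto
    moreover have "L * 1 \<le> L * cap" using assms by (intro mult_le_mono2) auto
    moreover have "(a + 8) * L \<le> (a + 8) * (L * cap)" using assms by (intro mult_le_mono2) auto
    moreover have "Suc (Suc L) \<le> 3 * L" using assms by simp
    ultimately show ?thesis by (simp add: algebra_simps)
  qed
  then have "real ((a + 8) * L + Suc L * Suc cap + Suc (Suc L) + (G * cap) * L)
      \<le> real ((a + 15 + G) * (L * cap))" by (simp only: of_nat_le_iff)
  also have "\<dots> = real (a + 15 + G) * (real L * real cap)" by simp
  also have "\<dots> \<le> real (a + 15 + G) * (real L * (128 * real ((a + 8) * L) * x))"
    using cap by (intro mult_left_mono) auto
  also have "\<dots> = 128 * real (a + 8) * real (a + 15 + G) * x * (real L)\<^sup>2"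
    by (simp add: power2_eq_square)
  also have "\<dots> \<le> 128 * real (a + 8) * real (a + 15 + G) * x * (2 * l)\<^sup>2"
    using L x by (intro mult_left_mono power_mono) auto
  finally have "real k * real ((a + 8) * L + Suc L * Suc cap + Suc (Suc L) + (G * cap) * L)
      \<le> real k * (128 * real (a + 8) * real (a + 15 + G) * x * (2 * l)\<^sup>2)"
    by (intro mult_left_mono) auto
  also have "\<dots> = 512 * real (a + 8) * real (a + 15 + G) * (real k * x * l\<^sup>2)"
    by (simp add: power_mult_distrib)
  finally show ?thesis by (simp only: of_nat_mult)
qed

theorem mainTheorem7:
  fixes \<Gamma> :: real and a :: nat
  assumes "\<Gamma> > 0"
  shows "\<exists>C>0. \<forall>(n::nat) (k::nat) (\<epsilon>::real) (\<gamma>::real).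
           n \<ge> 1 \<and> k \<ge> 1 \<and> 0 < \<epsilon> \<and> \<epsilon> < 1 \<and> 0 < \<gamma> \<and> \<gamma> \<le> \<Gamma> \<longrightarrow>
           (\<exists>P. continuous_difference_estimator n k (F0 n) \<gamma> \<epsilon> (1 / real n ^ a) P \<and>
                communication_at_most n k (F0 n) \<gamma> P
                  (C * (real k * \<gamma> / \<epsilon>\<^sup>2 * (log 2 (real n))\<^sup>2)))"
proof (intro exI[of _ "512 * real (a + 8) * real (a + 15 + Suc (nat \<lceil>4 * \<Gamma>\<rceil>))"] conjI allI impI)
  \<comment> \<open>\<open>G\<close> is at least \<open>1 + 4 * \<gamma>\<close> for all admissible
    \<open>\<gamma>\<close>, so that \<open>G * cap\<close> can serve as cutoff.\<close>
  define G where "G = Suc (nat \<lceil>4 * \<Gamma>\<rceil>)"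
  let ?C = "512 * real (a + 8) * real (a + 15 + Suc (nat \<lceil>4 * \<Gamma>\<rceil>))"
  show "0 < ?C" by simp
  fix n k :: nat and \<epsilon> \<gamma> :: real
  assume "n \<ge> 1 \<and> k \<ge> 1 \<and> 0 < \<epsilon> \<and> \<epsilon> < 1 \<and> 0 < \<gamma> \<and> \<gamma> \<le> \<Gamma>"
  then have n1: "1 \<le> n" and k: "1 \<le> k" and e: "0 < \<epsilon>" "\<epsilon> < 1" "0 < \<gamma>" "\<gamma> \<le> \<Gamma>" by auto
  let ?B = "?C * (real k * \<gamma> / \<epsilon>\<^sup>2 * (log 2 (real n))\<^sup>2)"
  show "\<exists>P. continuous_difference_estimator n k (F0 n) \<gamma> \<epsilon> (1 / real n ^ a) P \<and>
      communication_at_most n k (F0 n) \<gamma> P ?B"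
  \<comment> \<open>For \<open>n = 1\<close> the logarithm vanishes and no bit may be sent, but the
    permitted failure probability is 1.\<close>
  proof (cases "n = 1 \<or> \<gamma> \<le> \<epsilon>")
    case True
    then have "continuous_difference_estimator n k (F0 n) \<gamma> \<epsilon> (1 / real n ^ a) silent"
      by (intro estimator_silent) auto
    moreover have "communication_at_most n k (F0 n) \<gamma> silent ?B"
      using e by (intro communication_silent mult_nonneg_nonneg divide_nonneg_nonneg) auto
    ultimately show ?thesis by blast
  next
    case False
    then have n: "2 \<le> n" and eg: "\<epsilon> < \<gamma>" using n1 by auto
    define l where "l = log 2 (real n)"
    define L where "L = nat \<lceil>l\<rceil>"
    define x where "x = \<gamma> / \<epsilon>\<^sup>2"
    define y where "y = 64 * real ((a + 8) * L) * x"
    define cap where "cap = nat \<lceil>y\<rceil>"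
    have l1: "1 \<le> l" using n by (simp add: l_def le_log_iff)
    have Ll: "l \<le> real L" "real L \<le> 2 * l" using l1 unfolding L_def by linarith+
    have "real n = 2 powr l" using n by (simp add: l_def)
    also have "\<dots> \<le> 2 powr real L" using Ll by simp
    also have "\<dots> = real (2 ^ L)" by (simp add: powr_realpow)
    finally have nL: "n \<le> 2 ^ L" by (simp only: of_nat_le_iff)
    have "real n < real (2 ^ n)" using less_exp[of n] by (simp only: of_nat_less_iff)
    then have "l \<le> real n" using n by (simp add: l_def log_le_iff powr_realpow)
    then have Ln: "L \<le> n" unfolding L_def by linarith
    have L1: "1 \<le> L" using Ll l1 by linarith
    have "\<epsilon>\<^sup>2 \<le> \<epsilon> * 1" unfolding power2_eq_square using e by (intro mult_left_mono) auto
    then have x1: "1 \<le> x" using e eg by (simp add: x_def le_divide_eq)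
    have "1 * 1 \<le> (a + 8) * L" using L1 by (intro mult_le_mono) auto
    then have "1 * 1 \<le> real ((a + 8) * L) * x" using x1 by (intro mult_mono) linarith+
    then have y: "64 \<le> y" by (simp add: y_def)
    \<comment> \<open>Rounding up at most doubles \<open>y\<close>, because \<open>y\<close> is at
      least 64; likewise \<open>l \<ge> 1\<close> gave \<open>L \<le> 2 * l\<close>.\<close>
    then have cap: "2 \<le> cap" "y \<le> real cap" "real cap \<le> 2 * y" unfolding cap_def by linarith+
    have "4 * \<gamma> \<le> real (nat \<lceil>4 * \<Gamma>\<rceil>)" using e by linarith
    then have "(1 + 4 * \<gamma>) * real cap \<le> real G * real cap" by (intro mult_right_mono) (auto simp: G_def)
    then have lim: "real cap + 4 * \<gamma> * real cap \<le> real (G * cap)" by (simp add: algebra_simps)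
    obtain P where P: "continuous_difference_estimator n k (F0 n) \<gamma> \<epsilon> (1 / real n ^ a) P"
      "communication_at_most n k (F0 n) \<gamma> P
        (real (k * ((a + 8) * L + Suc L * Suc cap + Suc (Suc L) + (G * cap) * L)))"
      using ex_sampling_protocol[OF n nL Ln k e(1,2) eg cap(1) cap(2)[unfolded y_def x_def] lim] by blast
    have "real (k * ((a + 8) * L + Suc L * Suc cap + Suc (Suc L) + (G * cap) * L))
        \<le> 512 * real (a + 8) * real (a + 15 + G) * (real k * x * l\<^sup>2)"
      using cap x1 L1 Ll by (intro total_bits_le) (auto simp: y_def)
    also have "\<dots> = ?B" by (simp add: G_def x_def l_def)
    finally show ?thesis using P communication_at_most_mono by blast
  qed
qed

end
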